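(* Let $X$ be a Banach space and let $Y \subseteq X$ be a closed linear subspace. If $X$ is Grothendieck and the quotient $X/Y$ is reflexive, then $Y$ is Grothendieck.
   Context: A Banach space $Z$ is Grothendieck if every weak$^*$-convergent sequence in its topological dual $Z^*$ is weakly convergent in $Z^*$. *)

theory Defs
  imports "HOL-Analysis.Analysis"
begin

text \<open>The scalar field is \<open>\<real>\<close> or \<open>\<complex>\<close>: the two alternatives of the axiom say that \<open>'a\<close> is isometrically
  isomorphic to the former or to the latter.\<close>

class real_or_complex_field = real_normed_field +
  assumes real_or_complex:
    "(\<forall>z. \<exists>a. z = a *\<^sub>R 1) \<or>
     (\<exists>i. i * i = - 1 \<and>
       (\<forall>z. \<exists>a b. z = a *\<^sub>R 1 + b *\<^sub>R i \<and> norm z = sqrt (a\<^sup>2 + b\<^sup>2)))"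

instance real :: real_or_complex_field
  by standard simp

instance complex :: real_or_complex_field
proof
  have "\<exists>a b. z = a *\<^sub>R 1 + b *\<^sub>R \<i> \<and> norm z = sqrt (a\<^sup>2 + b\<^sup>2)" for z :: complex
    by (rule exI[of _ "Re z"], rule exI[of _ "Im z"]) (simp add: complex_eq_iff cmod_def)
  then show "(\<forall>z::complex. \<exists>a. z = a *\<^sub>R 1) \<or>
     (\<exists>i::complex. i * i = - 1 \<and>
       (\<forall>z. \<exists>a b. z = a *\<^sub>R 1 + b *\<^sub>R i \<and> norm z = sqrt (a\<^sup>2 + b\<^sup>2)))"
    by (intro disjI2 exI[of _ \<i>]) simp
qed

text \<open>A Banach space over \<open>'k\<close>. The class \<open>banach\<close> provides the complete norm (and a real
  multiplication); \<open>sc\<close> is the multiplication by \<open>'k\<close>-scalars.\<close>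

locale banach_space_over = vector_space sc
  for sc :: "'k::real_or_complex_field \<Rightarrow> 'a::banach \<Rightarrow> 'a" +
  assumes norm_scale: "norm (sc c x) = norm c * norm x"
    and scale_of_real: "sc (of_real r) x = r *\<^sub>R x"

lemma banach_space_over_scaleR: "banach_space_over (scaleR :: real \<Rightarrow> 'a::banach \<Rightarrow> 'a)"
  by unfold_locales (simp_all add: algebra_simps)

lemma banach_space_over_complex: "banach_space_over ((*) :: complex \<Rightarrow> complex \<Rightarrow> complex)"
  by unfold_locales (simp_all add: algebra_simps norm_mult scaleR_conv_of_real)

text \<open>Subspaces, quotients and duals depend on term parameters and hence are not types, so normed
  spaces are also represented by an explicit set of vectors with operations.\<close>

record ('k, 'v) nspace =
  vecs :: "'v set"
  vadd :: "'v \<Rightarrow> 'v \<Rightarrow> 'v"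
  vscale :: "'k \<Rightarrow> 'v \<Rightarrow> 'v"
  vnorm :: "'v \<Rightarrow> real"

definition subspace_nspace :: "('k \<Rightarrow> 'a \<Rightarrow> 'a) \<Rightarrow> 'a set \<Rightarrow> ('k, 'a::real_normed_vector) nspace" where
  "subspace_nspace sc Y = \<lparr>vecs = Y, vadd = (+), vscale = sc, vnorm = norm\<rparr>"

abbreviation whole_nspace :: "('k \<Rightarrow> 'a \<Rightarrow> 'a) \<Rightarrow> ('k, 'a::real_normed_vector) nspace" where
  "whole_nspace sc \<equiv> subspace_nspace sc UNIV"

text \<open>Vectors of the quotient are the cosets of \<open>Y\<close>. In the scalar multiplication \<open>y\<close> is added so that
  \<open>0\<close> times a coset is \<open>Y\<close> and not \<open>{0}\<close>. The quotient norm of \<open>x + Y\<close> is the infimum of the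
  norms of its elements.\<close>

definition quotient_nspace ::
    "('k \<Rightarrow> 'a \<Rightarrow> 'a) \<Rightarrow> 'a set \<Rightarrow> ('k, 'a::real_normed_vector set) nspace" where
  "quotient_nspace sc Y =
    \<lparr>vecs = {(\<lambda>y. x + y) ` Y | x. True},
     vadd = (\<lambda>A B. {a + b | a b. a \<in> A \<and> b \<in> B}),
     vscale = (\<lambda>c A. {sc c a + y | a y. a \<in> A \<and> y \<in> Y}),
     vnorm = (\<lambda>A. Inf (norm ` A))\<rparr>"

text \<open>Functionals are total functions, made to vanish outside \<open>vecs Z\<close> so that equality of
  functionals is equality on \<open>vecs Z\<close>.\<close>

definition dual :: "('k::real_normed_field, 'v) nspace \<Rightarrow> ('k, 'v \<Rightarrow> 'k) nspace" where
  "dual Z =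
    \<lparr>vecs = {f. (\<forall>x\<in>vecs Z. \<forall>y\<in>vecs Z. f (vadd Z x y) = f x + f y) \<and>
                (\<forall>c. \<forall>x\<in>vecs Z. f (vscale Z c x) = c * f x) \<and>
                (\<exists>B. \<forall>x\<in>vecs Z. norm (f x) \<le> B * vnorm Z x) \<and>
                (\<forall>x. x \<notin> vecs Z \<longrightarrow> f x = 0)},
     vadd = (\<lambda>f g x. f x + g x),
     vscale = (\<lambda>c f x. c * f x),
     vnorm = (\<lambda>f. Sup {norm (f x) | x. x \<in> vecs Z \<and> vnorm Z x \<le> 1})\<rparr>"

definition canonical_embedding ::
    "('k::real_normed_field, 'v) nspace \<Rightarrow> 'v \<Rightarrow> ('v \<Rightarrow> 'k) \<Rightarrow> 'k" where
  "canonical_embedding Z x = (\<lambda>f. if f \<in> vecs (dual Z) then f x else 0)"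

definition reflexive_nspace :: "('k::real_normed_field, 'v) nspace \<Rightarrow> bool" where
  "reflexive_nspace Z \<longleftrightarrow> canonical_embedding Z ` vecs Z = vecs (dual (dual Z))"

definition weakly_converges_to ::
    "('k::real_normed_field, 'v) nspace \<Rightarrow> (nat \<Rightarrow> 'v) \<Rightarrow> 'v \<Rightarrow> bool" where
  "weakly_converges_to Z x l \<longleftrightarrow> (\<forall>f\<in>vecs (dual Z). (\<lambda>n. f (x n)) \<longlonglongrightarrow> f l)"

definition weak_star_converges_to ::
    "('k::real_normed_field, 'v) nspace \<Rightarrow> (nat \<Rightarrow> 'v \<Rightarrow> 'k) \<Rightarrow> ('v \<Rightarrow> 'k) \<Rightarrow> bool" where
  "weak_star_converges_to Z f g \<longleftrightarrow> (\<forall>x\<in>vecs Z. (\<lambda>n. f n x) \<longlonglongrightarrow> g x)"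

definition grothendieck :: "('k::real_normed_field, 'v) nspace \<Rightarrow> bool" where
  "grothendieck Z \<longleftrightarrow>
    (\<forall>f. (\<forall>n. f n \<in> vecs (dual Z)) \<and> (\<exists>g\<in>vecs (dual Z). weak_star_converges_to Z f g) \<longrightarrow>
         (\<exists>h\<in>vecs (dual Z). weakly_converges_to (dual Z) f h))"

end

theory Submission
  imports Defs "HOL-Library.Diagonal_Subsequence"
begin

text \<open>Let \<open>f\<^sub>n\<close> be weak* convergent in \<open>Y\<^sup>*\<close>. By the uniform boundedness principle and Hahn-Banach, the
  \<open>f\<^sub>n\<close> have extensions \<open>F\<^sub>n\<close> to \<open>X\<close> of bounded norm. The point is that \<open>(F\<^sub>n)\<close> has a weak* convergent
  subsequence; it converges weakly as \<open>X\<close> is Grothendieck, and weak convergence survives restriction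
  to \<open>Y\<close>. Applied to all subsequences, this gives weak convergence of \<open>(f\<^sub>n)\<close>.

  If some \<open>(F\<^sub>n)\<close> had no weak* convergent subsequence then, by a diagonal argument, for some \<open>\<epsilon> > 0\<close>
  every subsequence of some subsequence could be split in two, with limits at least \<open>\<epsilon>\<close> apart at a
  vector of the unit ball. Iterated splitting yields a binary tree of subsequences. Weak* cluster
  points along its branches form an uncountable family in the annihilator of \<open>Y\<close>, which is the
  dual of \<open>X/Y\<close>, that is \<open>\<epsilon>\<close>-separated on a countable subset of the unit ball. But reflexivity of
  \<open>X/Y\<close> makes the duals of its separable subspaces separable.

  The analysis is done for real functionals; scalar functionals are recovered from their real parts.\<close>

section \<open>Hahn-Banach and uniform boundedness\<close>

text \<open>Partial extensions are represented by their graphs; domination by \<open>p\<close> already makes a linear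
  subspace of \<open>'a \<times> real\<close> single-valued.\<close>

lemma hahn_banach_dominated:
  fixes p :: "'a::real_vector \<Rightarrow> real" and f :: "'a \<Rightarrow> real"
  assumes p_add: "\<And>x y. p (x + y) \<le> p x + p y"
    and p_scale: "\<And>t x. 0 \<le> t \<Longrightarrow> p (t *\<^sub>R x) = t * p x"
    and S: "subspace S"
    and f_add: "\<And>x y. x \<in> S \<Longrightarrow> y \<in> S \<Longrightarrow> f (x + y) = f x + f y"
    and f_scale: "\<And>t x. x \<in> S \<Longrightarrow> f (t *\<^sub>R x) = t * f x"
    and f_le: "\<And>x. x \<in> S \<Longrightarrow> f x \<le> p x"
  obtains g where "linear g" "\<And>x. g x \<le> p x" "\<And>x. x \<in> S \<Longrightarrow> g x = f x"
proof -
  define G0 where "G0 = {z. fst z \<in> S \<and> snd z = f (fst z)}"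
  define \<A> where "\<A> = {G. subspace G \<and> G0 \<subseteq> G \<and> (\<forall>(x, a)\<in>G. a \<le> p x)}"
  have f0: "f 0 = 0" using f_scale[of 0 0] subspace_0[OF S] by simp
  have "subspace G0"
    unfolding subspace_def G0_def using subspace_add[OF S] subspace_scale[OF S] subspace_0[OF S]
    by (auto simp: f_add f_scale f0)
  then have "G0 \<in> \<A>"
    unfolding \<A>_def G0_def using f_le by auto
  moreover have "\<Union>\<C> \<in> \<A>" if "\<C> \<noteq> {}" "subset.chain \<A> \<C>" for \<C>
  proof -
    have sub: "C \<in> \<A>" if "C \<in> \<C>" for C
      using that \<open>subset.chain \<A> \<C>\<close> unfolding subset.chain_def by blast
    have tot: "C \<subseteq> D \<or> D \<subseteq> C" if "C \<in> \<C>" "D \<in> \<C>" for C D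
      using that \<open>subset.chain \<A> \<C>\<close> unfolding subset.chain_def by blast
    have "subspace (\<Union>\<C>)"
      unfolding subspace_def
    proof (intro conjI ballI allI)
      show "0 \<in> \<Union>\<C>" using sub \<open>\<C> \<noteq> {}\<close> subspace_0 unfolding \<A>_def by blast
    next
      fix x y assume "x \<in> \<Union>\<C>" "y \<in> \<Union>\<C>"
      then obtain C where "C \<in> \<C>" "x \<in> C" "y \<in> C" using tot by blast
      then show "x + y \<in> \<Union>\<C>" using sub subspace_add unfolding \<A>_def by blast
    next
      fix c x assume "x \<in> \<Union>\<C>"
      then show "c *\<^sub>R x \<in> \<Union>\<C>" using sub subspace_scale unfolding \<A>_def by blast
    qed
    then show ?thesis using sub \<open>\<C> \<noteq> {}\<close> unfolding \<A>_def by blast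
  qed
  ultimately obtain G where G: "G \<in> \<A>" and max: "\<And>H. H \<in> \<A> \<Longrightarrow> G \<subseteq> H \<Longrightarrow> H = G"
    using subset_Zorn_nonempty[of \<A>] by blast
  have subG: "subspace G" and G0G: "G0 \<subseteq> G" and G_le: "\<And>x a. (x, a) \<in> G \<Longrightarrow> a \<le> p x"
    using G unfolding \<A>_def by auto
  have p0: "p 0 = 0" using p_scale[of 0 0] by simp
  have uniq: "a = b" if "(x, a) \<in> G" "(x, b) \<in> G" for x a b
    using G_le[of 0 "a - b"] G_le[of 0 "b - a"] subspace_diff[OF subG that]
      subspace_diff[OF subG that(2,1)] p0 by simp
  have total: "\<exists>a. (x0, a) \<in> G" for x0
  proof -
    \<comment> \<open>A value \<open>c\<close> at \<open>x0\<close> that keeps domination must lie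
      above every \<open>a - p (x - x0)\<close> and below every \<open>p (x + x0) - a\<close>.
      Subadditivity of \<open>p\<close> orders the two families, so the supremum of the first one
      serves.\<close>
    define L where "L = {a - p (x - x0) | x a. (x, a) \<in> G}"
    have L: "a' - p (x' - x0) \<le> p (x + x0) - a" if "(x, a) \<in> G" "(x', a') \<in> G" for x a x' a'
      using G_le[of "x + x'" "a + a'"] subspace_add[OF subG that] p_add[of "x + x0" "x' - x0"]
      by (simp add: algebra_simps)
    have zG: "(0, 0) \<in> G" using subspace_0[OF subG] by (simp add: zero_prod_def)
    have bdd: "bdd_above L" using L[OF zG] unfolding L_def by (intro bdd_aboveI[of _ "p (0 + x0) - 0"]) blast
    have "L \<noteq> {}" using zG unfolding L_def by blast
    define c where "c = Sup L"
    have c1: "a - p (x - x0) \<le> c" if "(x, a) \<in> G" for x a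
      unfolding c_def by (rule cSup_upper[OF _ bdd]) (use that L_def in blast)
    have c2: "c \<le> p (x + x0) - a" if "(x, a) \<in> G" for x a
      unfolding c_def by (rule cSup_least[OF \<open>L \<noteq> {}\<close>]) (use L[OF that] L_def in blast)
    \<comment> \<open>The two bounds on \<open>c\<close> are the cases \<open>t = -1\<close> and
      \<open>t = 1\<close>; every other nonzero \<open>t\<close> reduces to one of them by scaling
      with \<open>1 / \<bar>t\<bar>\<close>.\<close>
    have key: "a + t * c \<le> p (x + t *\<^sub>R x0)" if xa: "(x, a) \<in> G" for x a t
    proof -
      consider "t = 0" | "t > 0" | "t < 0" by linarith
      then show ?thesis
      proof cases
        case 1 then show ?thesis using G_le[OF xa] by simp
      next
        case 2
        have "c \<le> p ((1/t) *\<^sub>R x + x0) - a / t"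
          using c2[of "(1/t) *\<^sub>R x" "a / t"] subspace_scale[OF subG xa, of "1/t"] by simp
        then have "t * c \<le> t * p ((1/t) *\<^sub>R x + x0) - a"
          using 2 by (simp add: field_simps)
        also have "t * p ((1/t) *\<^sub>R x + x0) = p (x + t *\<^sub>R x0)"
          using 2 by (subst p_scale[symmetric]) (auto simp: algebra_simps)
        finally show ?thesis by simp
      next
        case 3
        define s where "s = - t"
        have s: "s > 0" using 3 s_def by simp
        have "a / s - p ((1/s) *\<^sub>R x - x0) \<le> c"
          using c1[of "(1/s) *\<^sub>R x" "a / s"] subspace_scale[OF subG xa, of "1/s"] by simp
        then have "a - s * p ((1/s) *\<^sub>R x - x0) \<le> s * c"
          using s by (simp add: field_simps)
        moreover have "s * p ((1/s) *\<^sub>R x - x0) = p (x + t *\<^sub>R x0)"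
          using s by (subst p_scale[symmetric]) (auto simp: algebra_simps s_def)
        ultimately show ?thesis by (simp add: s_def)
      qed
    qed
    \<comment> \<open>Adjoining \<open>(x0, c)\<close> does not leave \<open>\<A>\<close>, so by
      maximality the pair already lies in \<open>G\<close>.\<close>
    define H where "H = span (insert (x0, c) G)"
    have "a \<le> p x" if "(x, a) \<in> H" for x a
    proof -
      obtain t where "(x, a) - t *\<^sub>R (x0, c) \<in> span G"
        using \<open>(x, a) \<in> H\<close> unfolding H_def span_breakdown_eq by blast
      then have "(x - t *\<^sub>R x0, a - t * c) \<in> G"
        using subG by (simp add: span_eq_iff[THEN iffD2])
      from key[OF this, of t] show ?thesis by simp
    qed
    moreover have GH: "G \<subseteq> H" "(x0, c) \<in> H" unfolding H_def by (auto intro: span_base)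
    moreover have "subspace H" unfolding H_def by simp
    ultimately have "H \<in> \<A>" unfolding \<A>_def using G0G by blast
    then show ?thesis using max GH by blast
  qed
  define g where "g x = (THE a. (x, a) \<in> G)" for x
  have gG: "(x, g x) \<in> G" for x
    unfolding g_def using total[of x] uniq by (metis theI)
  have geq: "g x = a" if "(x, a) \<in> G" for x a using gG uniq that by blast
  show ?thesis
  proof
    show "linear g"
      by (rule linearI; rule geq)
        (use subspace_add[OF subG gG gG] subspace_scale[OF subG gG] in auto)
    show "g x \<le> p x" for x using G_le[OF gG] .
    show "g x = f x" if "x \<in> S" for x
      using that G0G by (intro geq) (auto simp: G0_def)
  qed
qed

lemma hahn_banach_extension:
  fixes f :: "'a::real_normed_vector \<Rightarrow> real"
  assumes S: "subspace S"
    and f_add: "\<And>x y. x \<in> S \<Longrightarrow> y \<in> S \<Longrightarrow> f (x + y) = f x + f y"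
    and f_scale: "\<And>t x. x \<in> S \<Longrightarrow> f (t *\<^sub>R x) = t * f x"
    and f_le: "\<And>x. x \<in> S \<Longrightarrow> \<bar>f x\<bar> \<le> M * norm x"
    and "0 \<le> M"
  obtains F :: "'a \<Rightarrow>\<^sub>L real" where "\<And>x. x \<in> S \<Longrightarrow> blinfun_apply F x = f x" "norm F \<le> M"
proof -
  obtain g where g: "linear g" "\<And>x. g x \<le> M * norm x" "\<And>x. x \<in> S \<Longrightarrow> g x = f x"
  proof (rule hahn_banach_dominated[of "\<lambda>x. M * norm x" S f])
    show "M * norm (x + y) \<le> M * norm x + M * norm y" for x y :: 'a
      using mult_left_mono[OF norm_triangle_ineq \<open>0 \<le> M\<close>] by (simp add: distrib_left)
  qed (use assms in \<open>auto simp: abs_le_iff\<close>)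
  have bd: "norm (g x) \<le> norm x * M" for x
    using g(2)[of x] g(2)[of "- x"] linear_neg[OF g(1), of x] by (simp add: abs_le_iff mult.commute)
  have "bounded_linear g"
    using bd by (intro bounded_linear_intro[of g M])
      (auto simp: linear_add[OF g(1)] linear_scale[OF g(1)])
  then have apply_g: "blinfun_apply (Blinfun g) = g" by (rule bounded_linear_Blinfun_apply)
  show ?thesis
  proof
    show "norm (Blinfun g) \<le> M"
      using bd by (intro norm_blinfun_bound) (auto simp: apply_g \<open>0 \<le> M\<close> mult.commute)
  qed (simp add: apply_g g(3))
qed

text \<open>The distance to \<open>S\<close> is sublinear and at most the norm, so a functional
  dominated by it vanishes on \<open>S\<close> and has norm at most 1. On the line through
  \<open>x0\<close>, prescribing the distance as the value at \<open>x0\<close> respects the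
  domination.\<close>

lemma hahn_banach_separation:
  fixes S :: "'a::real_normed_vector set"
  assumes S: "subspace S"
  obtains F :: "'a \<Rightarrow>\<^sub>L real"
  where "\<And>x. x \<in> S \<Longrightarrow> blinfun_apply F x = 0" "norm F \<le> 1" "blinfun_apply F x0 = infdist x0 S"
proof -
  have ne: "S \<noteq> {}" using subspace_0[OF S] by blast
  have attained: "\<exists>s\<in>S. dist x s < infdist x S + e" if "e > 0" for x e
    using that cInf_lessD[of "dist x ` S" "infdist x S + e"] ne by (auto simp: infdist_notempty)
  have tri: "infdist (x + y) S \<le> infdist x S + infdist y S" for x y
  proof (rule field_le_epsilon)
    fix e :: real assume "e > 0"
    then obtain s where s: "s \<in> S" "dist x s < infdist x S + e / 2"
      using attained[of "e / 2" x] \<open>e > 0\<close> by auto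
    obtain t where t: "t \<in> S" "dist y t < infdist y S + e / 2"
      using attained[of "e / 2" y] \<open>e > 0\<close> by auto
    have "infdist (x + y) S \<le> dist (x + y) (s + t)"
      by (rule infdist_le[OF subspace_add[OF S s(1) t(1)]])
    also have "\<dots> \<le> dist x s + dist y t" by (rule dist_triangle_add)
    finally show "infdist (x + y) S \<le> infdist x S + infdist y S + e" using s t by simp
  qed
  have le: "infdist (t *\<^sub>R x) S \<le> \<bar>t\<bar> * infdist x S" for t x
  proof (rule field_le_epsilon)
    fix e :: real assume "e > 0"
    \<comment> \<open>The added 1 admits \<open>t = 0\<close>, and still
      \<open>\<bar>t\<bar> * d \<le> e\<close>.\<close>
    define d where "d = e / (\<bar>t\<bar> + 1)"
    have "d > 0" using \<open>e > 0\<close> by (simp add: d_def)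
    then obtain s where s: "s \<in> S" "dist x s < infdist x S + d"
      using attained by blast
    have "infdist (t *\<^sub>R x) S \<le> dist (t *\<^sub>R x) (t *\<^sub>R s)"
      by (rule infdist_le[OF subspace_scale[OF S s(1)]])
    also have "\<dots> = \<bar>t\<bar> * dist x s" by (simp add: dist_norm flip: scaleR_diff_right)
    also have "\<dots> \<le> \<bar>t\<bar> * (infdist x S + d)" using s(2) by (intro mult_left_mono) auto
    also have "\<bar>t\<bar> * (infdist x S + d) \<le> \<bar>t\<bar> * infdist x S + e"
      using \<open>e > 0\<close> by (simp add: d_def field_simps)
    finally show "infdist (t *\<^sub>R x) S \<le> \<bar>t\<bar> * infdist x S + e" .
  qed
  have scale: "infdist (t *\<^sub>R x) S = t * infdist x S" if "0 \<le> t" for t x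
  proof (cases "t = 0")
    case True then show ?thesis using subspace_0[OF S] by simp
  next
    case False
    then have "infdist x S \<le> (1/t) * infdist (t *\<^sub>R x) S"
      using le[of "1/t" "t *\<^sub>R x"] that by simp
    then show ?thesis using le[of t x] False that by (simp add: field_simps)
  qed
  have neg: "infdist (- x) S = infdist x S" for x
    using le[of "-1" x] le[of "-1" "-x"] by simp
  \<comment> \<open>The coordinate on the line is unique only for \<open>x0 \<noteq> 0\<close>. For
    \<open>x0 = 0\<close> the distance to \<open>S\<close> is 0, which agrees with the
    default.\<close>
  define f where "f x = (if x0 = 0 then 0 else (THE t. x = t *\<^sub>R x0) * infdist x0 S)" for x
  have f: "f (t *\<^sub>R x0) = t * infdist x0 S" for t
    using subspace_0[OF S] by (auto simp: f_def)
  obtain g where g: "linear g" "\<And>x. g x \<le> infdist x S" "\<And>x. x \<in> span {x0} \<Longrightarrow> g x = f x"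
  proof (rule hahn_banach_dominated[of "\<lambda>x. infdist x S" "span {x0}" f])
    show "subspace (span {x0})" by simp
    show "f (x + y) = f x + f y" if "x \<in> span {x0}" "y \<in> span {x0}" for x y
      using that by (auto simp: span_singleton f scaleR_add_left[symmetric] distrib_right simp del: scaleR_add_left)
    show "f x \<le> infdist x S" if x: "x \<in> span {x0}" for x
    proof -
      obtain t where t: "x = t *\<^sub>R x0" using x by (auto simp: span_singleton)
      show ?thesis
      proof (cases "t \<ge> 0")
        case True then show ?thesis by (simp add: t f scale)
      next
        case False
        then have "f x \<le> 0" by (simp add: t f mult_nonpos_nonneg[OF _ infdist_nonneg])
        also have "0 \<le> infdist x S" by (rule infdist_nonneg)
        finally show ?thesis .
      qed
    qed
  qed (auto simp: tri scale span_singleton f)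
  have abs: "\<bar>g x\<bar> \<le> infdist x S" for x
    using g(2)[of x] g(2)[of "- x"] linear_neg[OF g(1), of x] neg[of x] by (simp add: abs_le_iff)
  have inf_le: "infdist x S \<le> norm x" for x
    using infdist_le[OF subspace_0[OF S], of x] by simp
  have bd: "\<bar>g x\<bar> \<le> 1 * norm x" for x using abs[of x] inf_le[of x] by simp
  obtain F where F: "\<And>x. blinfun_apply F x = g x" "norm F \<le> 1"
    using hahn_banach_extension[of UNIV g 1] linear_add[OF g(1)] linear_scale[OF g(1)] bd by auto
  show ?thesis
  proof (rule that[OF _ F(2)])
    show "blinfun_apply F x = 0" if "x \<in> S" for x using abs[of x] that by (simp add: F)
    show "blinfun_apply F x0 = infdist x0 S"
      using g(3)[of x0] f[of 1] by (simp add: F span_base)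
  qed
qed

text \<open>Baire's theorem in the complete space \<open>Y\<close>: the closed sets
  \<open>A m\<close> cover \<open>Y\<close>, hence one of them contains a relative ball, and
  differences of points of that ball control all the functionals at once.\<close>

lemma uniform_boundedness_on:
  fixes F :: "nat \<Rightarrow> 'a::banach \<Rightarrow>\<^sub>L real"
  assumes Y: "subspace Y" "closed Y"
    and bdd: "\<And>y. y \<in> Y \<Longrightarrow> bounded (range (\<lambda>n. blinfun_apply (F n) y))"
  obtains M where "0 \<le> M" "\<And>n y. y \<in> Y \<Longrightarrow> \<bar>blinfun_apply (F n) y\<bar> \<le> M * norm y"
proof -
  define A where "A m = {y \<in> Y. \<forall>n. \<bar>blinfun_apply (F n) y\<bar> \<le> real m}" for m
  have A_eq: "A m = Y \<inter> (\<Inter>n. {y. \<bar>blinfun_apply (F n) y\<bar> \<le> real m})" for m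
    unfolding A_def by auto
  have "closed (A m)" for m
    unfolding A_eq using Y(2) by (intro closed_Int closed_INT ballI closed_Collect_le continuous_intros) auto
  then have A_cl: "closedin (top_of_set Y) (A m)" for m
    by (rule closed_subset[rotated]) (auto simp: A_def)
  have "\<exists>m. y \<in> A m" if "y \<in> Y" for y
  proof -
    obtain B where "\<And>n. \<bar>blinfun_apply (F n) y\<bar> \<le> B" using bdd[OF \<open>y \<in> Y\<close>] unfolding bounded_iff by auto
    moreover obtain m where "B \<le> real m" using real_arch_simple by blast
    ultimately show ?thesis unfolding A_def using that order_trans by blast
  qed
  then have UA: "(\<Union>m. A m) = Y" unfolding A_def by auto
  have cm: "completely_metrizable_space (top_of_set Y)"
    by (metis Y(2) closedin_closed_eq closed_closedin completely_metrizable_space_closedin completely_metrizable_space_euclidean)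
  have "\<exists>m. top_of_set Y interior_of A m \<noteq> {}"
  proof (rule ccontr)
    assume "\<not> ?thesis"
    then have "top_of_set Y interior_of \<Union>(range A) = {}"
      using Baire_category_alt[of "top_of_set Y" "range A"] cm A_cl by auto
    then have "top_of_set Y interior_of Y = {}" by (simp add: UA)
    moreover have "top_of_set Y interior_of Y = Y" by (metis interior_of_topspace topspace_euclidean_subtopology)
    ultimately show False using subspace_0[OF Y(1)] by blast
  qed
  then obtain m y0 U where U: "openin (top_of_set Y) U" "y0 \<in> U" "U \<subseteq> A m"
    unfolding interior_of_def by blast
  then obtain r where r: "r > 0" "ball y0 r \<inter> Y \<subseteq> U"
    by (meson openin_contains_ball)
  have y0: "y0 \<in> Y" "y0 \<in> A m" using U A_def by auto
  have "\<bar>blinfun_apply (F n) y\<bar> \<le> (4 * real m / r) * norm y" if y: "y \<in> Y" for n y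
  proof (cases "y = 0")
    case False
    \<comment> \<open>The vector \<open>t *\<^sub>R y\<close> has norm \<open>r / 2\<close>. Values
      of at most \<open>m\<close> at \<open>y0\<close> and at \<open>y0 + t *\<^sub>R y\<close> give
      at most \<open>2 * m\<close> at the difference; dividing by \<open>t\<close> produces the
      constant \<open>4 * m / r\<close>.\<close>
    define t where "t = r / (2 * norm y)"
    have t: "t > 0" "norm (t *\<^sub>R y) < r" using False r by (auto simp: t_def)
    have "y0 + t *\<^sub>R y \<in> A m"
      using r U t y0 y subspace_add[OF Y(1) y0(1) subspace_scale[OF Y(1) y]]
      by (auto simp: subset_iff dist_norm)
    then have "\<bar>blinfun_apply (F n) (y0 + t *\<^sub>R y)\<bar> \<le> m" "\<bar>blinfun_apply (F n) y0\<bar> \<le> m"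
      using y0 unfolding A_def by auto
    then have "t * \<bar>blinfun_apply (F n) y\<bar> \<le> 2 * m"
      using t by (simp add: blinfun.add_right blinfun.scaleR_right)
    then show ?thesis using False r(1) by (simp add: t_def field_simps)
  qed simp
  then show ?thesis using r(1) by (intro that[of "4 * real m / r"]) auto
qed

section \<open>Separability of duals\<close>

text \<open>The dense set consists of the rational combinations, coded as finite lists of pairs of
  coefficient and vector; its countability is that of the lists over a countable set.\<close>

lemma countable_dense_in_span:
  fixes A :: "'a::real_normed_vector set"
  assumes "countable A"
  obtains D where "countable D" "D \<subseteq> span A" "span A \<subseteq> closure D"
proof
  define \<phi> where "\<phi> l = (\<Sum>(c, a)\<leftarrow>l. real_of_rat c *\<^sub>R a)" for l :: "(rat \<times> 'a) list"
  let ?D = "\<phi> ` lists (UNIV \<times> A)"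
  show "countable ?D" using assms by simp
  have "\<phi> l \<in> span A" if "l \<in> lists (UNIV \<times> A)" for l
    using that by (induction l) (auto simp: \<phi>_def intro: span_add span_scale span_base span_zero)
  then show "?D \<subseteq> span A" by blast
  show "span A \<subseteq> closure ?D"
  proof
    fix x assume "x \<in> span A"
    then show "x \<in> closure ?D"
    proof (induction rule: span_induct_alt)
      case base
      have "\<phi> [] = 0" "[] \<in> lists (UNIV \<times> A)" by (simp_all add: \<phi>_def)
      then have "0 \<in> ?D" by (metis image_eqI)
      then show ?case by (rule subsetD[OF closure_subset])
    next
      case (step c a y)
      show ?case
        unfolding closure_approachable
      proof (intro allI impI)
        fix e :: real assume "e > 0"
        then obtain l where l: "l \<in> lists (UNIV \<times> A)" "dist (\<phi> l) y < e / 2"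
          using step(2)[unfolded closure_approachable, rule_format, of "e / 2"] by auto
        \<comment> \<open>Half of \<open>e\<close> is spent on the tail \<open>y\<close>, the other
          half on the coefficient of \<open>a\<close>; the added 1 covers
          \<open>a = 0\<close>.\<close>
        define d where "d = e / (2 * (norm a + 1))"
        have d: "d > 0" using \<open>e > 0\<close> norm_ge_zero[of a] by (simp add: d_def add_nonneg_pos)
        then obtain q where q: "\<bar>real_of_rat q - c\<bar> < d"
          using of_rat_dense[of "c - d" "c + d"] by (auto simp: abs_less_iff algebra_simps)
        have "dist (\<phi> ((q, a) # l)) (c *\<^sub>R a + y) = norm ((real_of_rat q - c) *\<^sub>R a + (\<phi> l - y))"
          by (simp add: \<phi>_def dist_norm algebra_simps)
        also have "\<dots> \<le> \<bar>real_of_rat q - c\<bar> * norm a + dist (\<phi> l) y"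
          using norm_triangle_ineq by (metis dist_norm norm_scaleR)
        also have "\<bar>real_of_rat q - c\<bar> * norm a \<le> d * norm a"
          using q by (intro mult_right_mono) auto
        also have "d * norm a \<le> e / 2"
        proof -
          have "d * norm a \<le> d * (norm a + 1)" using d by simp
          also have "\<dots> = e / 2"
            unfolding d_def using add_nonneg_pos[OF norm_ge_zero[of a] zero_less_one]
            by (metis less_numeral_extra(3) mult.commute nonzero_mult_divide_mult_cancel_right
                times_divide_eq_left)
          finally show ?thesis .
        qed
        finally have "dist (\<phi> ((q, a) # l)) (c *\<^sub>R a + y) < e" using l(2) by simp
        moreover have "\<phi> ((q, a) # l) \<in> ?D" using l(1) step(1) by auto
        ultimately show "\<exists>z\<in>?D. dist z (c *\<^sub>R a + y) < e" by blast
      qed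
    qed
  qed
qed

text \<open>For a closed subspace this is the dual of the quotient, realised inside the dual of the
  whole space, so that the real analysis can do without cosets.\<close>

definition annihilator :: "'a::real_normed_vector set \<Rightarrow> ('a \<Rightarrow>\<^sub>L real) set" where
  "annihilator S = {F. \<forall>x\<in>S. blinfun_apply F x = 0}"

lemma subspace_annihilator: "subspace (annihilator S)"
  by (auto simp: subspace_def annihilator_def blinfun.add_left blinfun.scaleR_left)

text \<open>The separating functional for \<open>span S\<close> lies in the annihilator and its
  value at \<open>x\<close> is the distance from \<open>x\<close> to the span, which the assumption
  forces to be 0.\<close>

lemma closure_span_eq_zero:
  assumes "\<And>F. F \<in> annihilator S \<Longrightarrow> blinfun_apply F x = 0"
  shows "x \<in> closure (span S)"
proof -
  obtain F :: "'a \<Rightarrow>\<^sub>L real" where F: "\<And>x. x \<in> span S \<Longrightarrow> blinfun_apply F x = 0"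
    "blinfun_apply F x = infdist x (span S)"
    using hahn_banach_separation[OF subspace_span] by metis
  then have "infdist x (span S) = 0"
    using assms[of F] by (simp add: annihilator_def span_base)
  then show ?thesis
    by (subst in_closure_iff_infdist_zero) (use span_zero in blast)+
qed

lemma blinfun_le_norm:
  fixes F :: "'a::real_normed_vector \<Rightarrow>\<^sub>L real"
  assumes "norm F \<le> 1"
  shows "blinfun_apply F x \<le> norm x"
  using norm_blinfun[of F x] mult_right_mono[OF assms norm_ge_zero[of x]] by simp

lemma annihilator_le_infdist:
  assumes "F \<in> annihilator Y" "norm F \<le> 1" "Y \<noteq> {}"
  shows "blinfun_apply F x \<le> infdist x Y"
proof -
  have "blinfun_apply F x \<le> dist x y" if "y \<in> Y" for y
    using blinfun_le_norm[OF assms(2), of "x - y"] assms(1) that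
    by (simp add: annihilator_def blinfun.diff_right dist_norm)
  then show ?thesis
    using assms(3) by (auto simp: infdist_notempty intro!: cINF_greatest)
qed

text \<open>Here \<open>refl\<close> is reflexivity of the quotient by \<open>Y\<close>: on the
  annihilator every bounded functional is evaluation at a vector. The lemma is separability of the
  dual of the separable subspace generated by \<open>C\<close> in the quotient. \<open>V\<close> is
  built from functionals \<open>q d\<close> that norm the cosets of a countable dense set of vectors
  \<open>d\<close>.\<close>

lemma annihilator_countable_approximation:
  fixes Y :: "'a::real_normed_vector set"
  assumes Y: "subspace Y" "closed Y"
    and refl: "\<And>\<Phi> :: ('a \<Rightarrow>\<^sub>L real) \<Rightarrow>\<^sub>L real.
      \<exists>x. \<forall>F\<in>annihilator Y. blinfun_apply \<Phi> F = blinfun_apply F x"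
    and "countable C"
  obtains V where "countable V"
    "\<And>p \<delta>. p \<in> annihilator Y \<Longrightarrow> \<delta> > 0 \<Longrightarrow>
      \<exists>v\<in>V. \<forall>x\<in>C. \<bar>blinfun_apply p x - blinfun_apply v x\<bar> \<le> \<delta> * norm x"
proof -
  obtain D where D: "countable D" "D \<subseteq> span C" "span C \<subseteq> closure D"
    using countable_dense_in_span[OF \<open>countable C\<close>] by blast
  have "\<exists>F\<in>annihilator Y. norm F \<le> 1 \<and> blinfun_apply F x = infdist x Y" for x
  proof -
    obtain F :: "'a \<Rightarrow>\<^sub>L real" where "\<And>y. y \<in> Y \<Longrightarrow> blinfun_apply F y = 0" "norm F \<le> 1"
      "blinfun_apply F x = infdist x Y"
      using hahn_banach_separation[OF Y(1)] by metis
    then show ?thesis unfolding annihilator_def by blast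
  qed
  then have "\<forall>x. \<exists>F. F \<in> annihilator Y \<and> norm F \<le> 1 \<and> blinfun_apply F x = infdist x Y"
    by blast
  then obtain q where "\<forall>x. q x \<in> annihilator Y \<and> norm (q x) \<le> 1 \<and> blinfun_apply (q x) x = infdist x Y"
    unfolding choice_iff by blast
  then have q: "\<And>x. q x \<in> annihilator Y" "\<And>x. norm (q x) \<le> 1"
    "\<And>x. blinfun_apply (q x) x = infdist x Y"
    by auto
  obtain V where V: "countable V" "V \<subseteq> span (q ` D)" "span (q ` D) \<subseteq> closure V"
    using countable_dense_in_span[OF countable_image[OF D(1), of q]] by blast
  let ?N = "annihilator (C \<union> Y)"
  have NY: "?N \<subseteq> annihilator Y" by (auto simp: annihilator_def)
  have spanY: "span Y = Y" using Y(1) by simp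
  have spanN: "span ?N = ?N" using subspace_annihilator by simp
  \<comment> \<open>By Hahn-Banach, density follows once every \<open>\<Phi>\<close> that kills all
    \<open>q d\<close> and \<open>?N\<close> kills \<open>p\<close>. Such a \<open>\<Phi>\<close> is
    evaluation at some \<open>x\<close>; killing \<open>?N\<close> puts \<open>x\<close> in the
    closed span of \<open>C \<union> Y\<close>, and killing the \<open>q d\<close> will put it in
    \<open>Y\<close>.\<close>
  have p_in: "p \<in> closure (span (q ` D \<union> ?N))" if p: "p \<in> annihilator Y" for p
  proof (rule closure_span_eq_zero)
    fix \<Phi> :: "('a \<Rightarrow>\<^sub>L real) \<Rightarrow>\<^sub>L real"
    assume \<Phi>: "\<Phi> \<in> annihilator (q ` D \<union> ?N)"
    obtain x where x: "\<And>F. F \<in> annihilator Y \<Longrightarrow> blinfun_apply \<Phi> F = blinfun_apply F x"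
      using refl[of \<Phi>] by blast
    have "x \<in> closure (span (C \<union> Y))"
    proof (rule closure_span_eq_zero)
      fix F assume "F \<in> annihilator (C \<union> Y)"
      then show "blinfun_apply F x = 0" using \<Phi> NY x[of F] by (auto simp: annihilator_def)
    qed
    \<comment> \<open>Approximate \<open>x\<close> by \<open>d + y\<close> up to
      \<open>e / 2\<close>. As \<open>q d\<close> vanishes at \<open>x\<close> and on
      \<open>Y\<close>, it shows that \<open>d\<close> is within \<open>e / 2\<close> of
      \<open>Y\<close>; then the norming functional \<open>q x\<close> bounds the distance of
      \<open>x\<close> by \<open>e\<close>.\<close>
    have "infdist x Y \<le> 0 + e" if "e > 0" for e
    proof -
      obtain z where z: "z \<in> span (C \<union> Y)" "dist z x < e / 4"
        using \<open>x \<in> closure (span (C \<union> Y))\<close>[unfolded closure_approachable, rule_format, of "e / 4"]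
          \<open>e > 0\<close> by auto
      then obtain u y where u: "u \<in> span C" "y \<in> Y" "z = u + y"
        unfolding span_Un spanY by blast
      obtain d where d: "d \<in> D" "dist d u < e / 4"
        using subsetD[OF D(3) u(1), unfolded closure_approachable, rule_format, of "e / 4"]
          \<open>e > 0\<close> by auto
      have "norm (x - (d + y)) \<le> dist z x + dist d u"
        using norm_triangle_ineq[of "x - z" "u - d"]
        by (simp add: u(3) dist_norm norm_minus_commute algebra_simps)
      then have close: "norm (x - (d + y)) \<le> e / 2" using z d by simp
      have qd: "blinfun_apply (q d) x = 0"
      proof -
        have "blinfun_apply \<Phi> (q d) = 0" using \<Phi> d(1) unfolding annihilator_def by blast
        then show ?thesis using x[OF q(1), of d] by simp
      qed
      have "infdist d Y = - blinfun_apply (q d) (x - (d + y))"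
        using q(1)[of d] u(2) qd q(3)[of d]
        by (simp add: annihilator_def blinfun.diff_right blinfun.add_right)
      also have "\<dots> \<le> norm (x - (d + y))"
        using blinfun_le_norm[OF q(2)[of d], of "- (x - (d + y))"]
        by (simp only: blinfun.minus_right norm_minus_cancel)
      finally have "infdist d Y \<le> e / 2" using close by simp
      have "infdist x Y = blinfun_apply (q x) (x - (d + y)) + blinfun_apply (q x) d"
        using q(1)[of x] q(3)[of x] u(2) by (simp add: annihilator_def blinfun.diff_right blinfun.add_right)
      also have "blinfun_apply (q x) (x - (d + y)) \<le> norm (x - (d + y))"
        using blinfun_le_norm[OF q(2)] .
      also have "blinfun_apply (q x) d \<le> infdist d Y"
        using annihilator_le_infdist[OF q(1,2)] subspace_0[OF Y(1)] by blast
      finally have "infdist x Y \<le> e" using close \<open>infdist d Y \<le> e / 2\<close> by simp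
      then show ?thesis by simp
    qed
    then have "infdist x Y \<le> 0" by (rule field_le_epsilon)
    then have "x \<in> Y"
      using Y subspace_0[OF Y(1)] infdist_nonneg[of x Y] by (subst in_closed_iff_infdist_zero) auto
    then show "blinfun_apply \<Phi> p = 0" using x[OF p] p by (simp add: annihilator_def)
  qed
  show ?thesis
  proof (rule that[OF V(1)])
    fix p :: "'a \<Rightarrow>\<^sub>L real" and \<delta> :: real
    assume p: "p \<in> annihilator Y" and "\<delta> > 0"
    then obtain t where t: "t \<in> span (q ` D \<union> ?N)" "dist t p < \<delta> / 2"
      using p_in[OF p, unfolded closure_approachable, rule_format, of "\<delta> / 2"] by auto
    then obtain a b where ab: "a \<in> span (q ` D)" "b \<in> ?N" "t = a + b"
      unfolding span_Un spanN by blast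
    obtain v where v: "v \<in> V" "dist v a < \<delta> / 2"
      using subsetD[OF V(3) ab(1), unfolded closure_approachable, rule_format, of "\<delta> / 2"]
        \<open>\<delta> > 0\<close> by auto
    have "\<bar>blinfun_apply p x - blinfun_apply v x\<bar> \<le> \<delta> * norm x" if "x \<in> C" for x
    proof -
      have le: "norm (p - t - (v - a)) \<le> \<delta>"
        using norm_triangle_ineq4[of "p - t" "v - a"] t(2) v(2) by (simp add: dist_norm norm_minus_commute)
      \<comment> \<open>The component \<open>b\<close> vanishes on \<open>C\<close>, so on
        \<open>C\<close> it is enough that \<open>v\<close> approximates \<open>a\<close>.\<close>
      have "blinfun_apply p x - blinfun_apply v x = blinfun_apply (p - t - (v - a)) x"
        using ab(2) that by (simp add: ab(3) annihilator_def blinfun.diff_left blinfun.add_left)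
      then show ?thesis
        using order_trans[OF norm_blinfun mult_right_mono[OF le norm_ge_zero[of x]]] by simp
    qed
    then show "\<exists>v\<in>V. \<forall>x\<in>C. \<bar>blinfun_apply p x - blinfun_apply v x\<bar> \<le> \<delta> * norm x"
      using v(1) by blast
  qed
qed

lemma uncountable_binary_sequences: "\<not> countable (UNIV :: (nat \<Rightarrow> bool) set)"
proof
  assume "countable (UNIV :: (nat \<Rightarrow> bool) set)"
  then obtain f :: "nat \<Rightarrow> nat \<Rightarrow> bool" where "range f = UNIV"
    by (metis UNIV_not_empty range_from_nat_into)
  then obtain n where "f n = (\<lambda>n. \<not> f n n)" by (metis UNIV_I imageE)
  then show False by metis
qed

section \<open>Pointwise convergent subsequences\<close>

lemma hahn_banach_limit:
  fixes G :: "nat \<Rightarrow> 'a::real_normed_vector \<Rightarrow>\<^sub>L real"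
  assumes bound: "\<And>n. norm (G n) \<le> M"
  obtains p :: "'a \<Rightarrow>\<^sub>L real"
  where "\<And>x l. (\<lambda>n. blinfun_apply (G n) x) \<longlonglongrightarrow> l \<Longrightarrow> blinfun_apply p x = l"
proof -
  \<comment> \<open>Extending the limit from the subspace where it exists replaces a weak* cluster point.\<close>
  define S where "S = {x. convergent (\<lambda>n. blinfun_apply (G n) x)}"
  define f where "f x = lim (\<lambda>n. blinfun_apply (G n) x)" for x
  have f: "(\<lambda>n. blinfun_apply (G n) x) \<longlonglongrightarrow> f x" if "x \<in> S" for x
    using that unfolding S_def f_def by (simp add: convergent_LIMSEQ_iff)
  have S: "x \<in> S" "f x = l" if "(\<lambda>n. blinfun_apply (G n) x) \<longlonglongrightarrow> l" for x l
    using that limI unfolding S_def f_def convergent_def by auto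
  have add: "(\<lambda>n. blinfun_apply (G n) (x + y)) \<longlonglongrightarrow> f x + f y" if "x \<in> S" "y \<in> S" for x y
    using tendsto_add[OF f f] that by (simp add: blinfun.add_right)
  have scale: "(\<lambda>n. blinfun_apply (G n) (t *\<^sub>R x)) \<longlonglongrightarrow> t * f x" if "x \<in> S" for t x
    using tendsto_mult_left[OF f] that by (simp add: blinfun.scaleR_right)
  have le: "norm (blinfun_apply (G n) x) \<le> M * norm x" for n x
    by (rule order_trans[OF norm_blinfun mult_right_mono[OF bound norm_ge_zero]])
  obtain p :: "'a \<Rightarrow>\<^sub>L real" where p: "\<And>x. x \<in> S \<Longrightarrow> blinfun_apply p x = f x"
  proof (rule hahn_banach_extension[of S f M])
    show "subspace S"
      unfolding subspace_def using S(1)[OF add] S(1)[OF scale] S(1)[of 0 0]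
      by (simp add: blinfun.zero_right)
    show "\<bar>f x\<bar> \<le> M * norm x" if "x \<in> S" for x
      using tendsto_rabs[OF f[OF that]] le by (rule_tac LIMSEQ_le_const2) auto
    show "0 \<le> M" using bound[of 0] norm_ge_zero order_trans by blast
  qed (use add scale S(2) in auto)
  then show ?thesis using S that by metis
qed

section \<open>Oscillation and the binary tree of subsequences\<close>

text \<open>A quantitative form of pointwise convergence: the index \<open>N\<close> may depend on
  \<open>x\<close>, and having the property for all \<open>e > 0\<close> makes the sequence Cauchy
  at every vector of the unit ball.\<close>

definition eventually_oscillates_at_most :: "real \<Rightarrow> (nat \<Rightarrow> 'a::real_normed_vector \<Rightarrow>\<^sub>L real) \<Rightarrow> bool" where
  "eventually_oscillates_at_most e F \<longleftrightarrow>
    (\<forall>x. norm x \<le> 1 \<longrightarrow>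
      (\<exists>N. \<forall>m\<ge>N. \<forall>n\<ge>N. \<bar>blinfun_apply (F m) x - blinfun_apply (F n) x\<bar> \<le> e))"

text \<open>Subsequences are taken along maps with \<open>n \<le> r n\<close>, which need not be
  increasing. This condition survives composition and suffices for limits; monotonicity is restored
  later.\<close>

lemma eventually_oscillates_at_most_compose:
  fixes r :: "nat \<Rightarrow> nat"
  assumes "eventually_oscillates_at_most e F" "\<And>n. n \<le> r n"
  shows "eventually_oscillates_at_most e (F \<circ> r)"
  using assms unfolding eventually_oscillates_at_most_def o_def by (meson order_trans)

text \<open>At a vector where the oscillation exceeds \<open>e\<close>, two index sequences give
  values more than \<open>e\<close> apart. Bounded values have convergent subsequences, and the
  strict separation becomes a weak one in the limit.\<close>

lemma oscillation_split:
  fixes F :: "nat \<Rightarrow> 'a::real_normed_vector \<Rightarrow>\<^sub>L real"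
  assumes bound: "\<And>n. norm (F n) \<le> M"
    and osc: "\<not> eventually_oscillates_at_most e F"
  obtains x and l :: "bool \<Rightarrow> nat \<Rightarrow> nat" and a :: "bool \<Rightarrow> real"
  where "norm x \<le> 1" "\<And>b n. n \<le> l b n"
    "\<And>b. (\<lambda>n. blinfun_apply (F (l b n)) x) \<longlonglongrightarrow> a b" "e \<le> \<bar>a True - a False\<bar>"
proof -
  obtain x where x: "norm x \<le> 1"
    "\<forall>N. \<exists>m n. m \<ge> N \<and> n \<ge> N \<and> e < \<bar>blinfun_apply (F m) x - blinfun_apply (F n) x\<bar>"
    using osc unfolding eventually_oscillates_at_most_def by (auto simp: not_le)
  from x(2) obtain m n where mn: "\<And>N. m N \<ge> N" "\<And>N. n N \<ge> N"
    "\<And>N. e < \<bar>blinfun_apply (F (m N)) x - blinfun_apply (F (n N)) x\<bar>"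
    unfolding choice_iff by blast
  have le: "norm (blinfun_apply (F n) x) \<le> M" for n
    using norm_blinfun[of "F n" x] mult_mono[OF bound[of n] x(1)] norm_ge_zero[of "F n"] bound[of n]
    by simp
  \<comment> \<open>The values are paired so that a single subsequence makes both converge.\<close>
  define u where "u N = (blinfun_apply (F (m N)) x, blinfun_apply (F (n N)) x)" for N
  have "bounded (range u)"
    by (rule bounded_subset[OF bounded_Times[OF bounded_cball[of 0 M] bounded_cball[of 0 M]]])
      (use le in \<open>auto simp: u_def\<close>)
  then obtain a b r where r: "strict_mono (r :: nat \<Rightarrow> nat)" "(u \<circ> r) \<longlonglongrightarrow> (a, b)"
    using bounded_imp_convergent_subsequence by (metis prod.collapse)
  have lim: "(\<lambda>k. blinfun_apply (F (m (r k))) x) \<longlonglongrightarrow> a" "(\<lambda>k. blinfun_apply (F (n (r k))) x) \<longlonglongrightarrow> b"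
    using tendsto_fst[OF r(2)] tendsto_snd[OF r(2)] by (simp_all add: u_def)
  have "e \<le> \<bar>a - b\<bar>"
    by (rule LIMSEQ_le_const[OF tendsto_rabs[OF tendsto_diff[OF lim]]]) (use mn(3) in \<open>auto intro: less_imp_le\<close>)
  show ?thesis
  proof (rule that[of x "\<lambda>b k. if b then m (r k) else n (r k)" "\<lambda>c. if c then a else b"])
    show "k \<le> (if c then m (r k) else n (r k))" for c k
      using mn(1)[of "r k"] mn(2)[of "r k"] seq_suble[OF r(1), of k] by auto
  qed (use x(1) lim \<open>e \<le> \<bar>a - b\<bar>\<close> in auto)
qed

text \<open>If it fails, \<open>oscillation_split\<close> applies at every node of a binary tree.
  The branches give functionals \<open>p \<sigma>\<close> in the annihilator that are
  \<open>e\<close>-separated on the countably many vectors \<open>X (N s)\<close>, against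
  \<open>annihilator_countable_approximation\<close>.\<close>

lemma ex_subseq_small_oscillation:
  fixes F :: "nat \<Rightarrow> 'a::banach \<Rightarrow>\<^sub>L real"
  assumes Y: "subspace Y" "closed Y"
    and refl: "\<And>\<Phi> :: ('a \<Rightarrow>\<^sub>L real) \<Rightarrow>\<^sub>L real.
      \<exists>x. \<forall>F\<in>annihilator Y. blinfun_apply \<Phi> F = blinfun_apply F x"
    and bound: "\<And>n. norm (F n) \<le> M"
    and null: "\<And>y. y \<in> Y \<Longrightarrow> (\<lambda>n. blinfun_apply (F n) y) \<longlonglongrightarrow> 0"
    and "e > 0"
  obtains (r_exists) r where "\<And>n::nat. n \<le> r n" "eventually_oscillates_at_most e (F \<circ> r)"
proof (rule ccontr)
  assume no: "\<not> thesis"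
  have osc: "\<not> eventually_oscillates_at_most e (F \<circ> r)" if "\<And>n. n \<le> r n" for r
    using no r_exists[OF that] by blast
  \<comment> \<open>Stating the split as an implication makes the choice total in \<open>r\<close>:
    \<open>X r\<close> is the splitting vector, \<open>L r b\<close> the two refinements and
    \<open>A r b\<close> the two limits.\<close>
  have "\<exists>x l a. (\<forall>n. n \<le> r n) \<longrightarrow> norm x \<le> 1 \<and> (\<forall>b n. n \<le> l b n) \<and>
    (\<forall>b. (\<lambda>n. blinfun_apply (F (r (l b n))) x) \<longlonglongrightarrow> a b) \<and> e \<le> \<bar>a True - a False\<bar>" for r
  proof (cases "\<forall>n. n \<le> r n")
    case True
    show ?thesis
      by (rule oscillation_split[of "F \<circ> r" M e]) (use bound osc[of r] True in \<open>auto simp: o_def\<close>)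
  qed blast
  then have "\<forall>r. \<exists>x l a. (\<forall>n. n \<le> r n) \<longrightarrow> norm x \<le> 1 \<and> (\<forall>b n. n \<le> l b n) \<and>
    (\<forall>b. (\<lambda>n. blinfun_apply (F (r (l b n))) x) \<longlonglongrightarrow> a b) \<and> e \<le> \<bar>a True - a False\<bar>" by blast
  then obtain X L A where XLA: "\<forall>r. (\<forall>n. n \<le> r n) \<longrightarrow> norm (X r) \<le> 1 \<and> (\<forall>b n. n \<le> L r b n) \<and>
    (\<forall>b. (\<lambda>n. blinfun_apply (F (r (L r b n))) (X r)) \<longlonglongrightarrow> A r b) \<and> e \<le> \<bar>A r True - A r False\<bar>"
    unfolding choice_iff by blast
  have X: "norm (X r) \<le> 1" and L: "n \<le> L r b n"
    and A: "(\<lambda>n. blinfun_apply (F (r (L r b n))) (X r)) \<longlonglongrightarrow> A r b"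
    and sep: "e \<le> \<bar>A r True - A r False\<bar>" if "\<And>n. n \<le> r n" for r b n
    using XLA that by blast+
  \<comment> \<open>\<open>N s\<close> is the subsequence at the node of the tree reached by the choices \<open>s\<close>, latest choice first.\<close>
  define N where "N s = foldr (\<lambda>b r. r \<circ> L r b) s id" for s
  have N_Cons: "N (b # s) = N s \<circ> L (N s) b" for b s by (simp add: N_def)
  have N_ge: "n \<le> N s n" for n s
  proof (induction s arbitrary: n)
    case (Cons b s)
    have "n \<le> L (N s) b n" by (rule L[OF Cons])
    also have "\<dots> \<le> N s (L (N s) b n)" by (rule Cons)
    finally show ?case by (simp add: N_Cons)
  qed (simp add: N_def)
  define pre where "pre \<sigma> n = rev (map \<sigma> [0..<n])" for \<sigma> :: "nat \<Rightarrow> bool" and n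
  have pre_Suc: "pre \<sigma> (Suc n) = \<sigma> n # pre \<sigma> n" for \<sigma> n by (simp add: pre_def)
  \<comment> \<open>Every later node on a branch refines each earlier one.\<close>
  have factor: "\<exists>w. N (pre \<sigma> (m + j)) = N (pre \<sigma> m) \<circ> w \<and> (\<forall>n. n \<le> w n)" for \<sigma> m j
  proof (induction j)
    case 0 show ?case by (rule exI[of _ id]) simp
  next
    case (Suc j)
    then obtain w where w: "N (pre \<sigma> (m + j)) = N (pre \<sigma> m) \<circ> w" "\<And>n. n \<le> w n" by blast
    let ?l = "L (N (pre \<sigma> (m + j))) (\<sigma> (m + j))"
    have "N (pre \<sigma> (m + Suc j)) = N (pre \<sigma> m) \<circ> (w \<circ> ?l)"
      by (simp add: pre_Suc N_Cons w(1) o_assoc)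
    moreover have "n \<le> (w \<circ> ?l) n" for n
    proof -
      have "n \<le> ?l n" by (rule L[OF N_ge])
      then show ?thesis using w(2)[of "?l n"] by simp
    qed
    ultimately show ?case by blast
  qed
  \<comment> \<open>The diagonal along the branch \<open>\<sigma>\<close>: from position
    \<open>m\<close> on it runs inside the subsequence at depth \<open>m\<close>. The functional
    \<open>p \<sigma>\<close> obtained below stands for a weak* cluster point along it.\<close>
  define d where "d \<sigma> k = N (pre \<sigma> k) k" for \<sigma> k
  have "\<exists>p :: 'a \<Rightarrow>\<^sub>L real. \<forall>x l. (\<lambda>k. blinfun_apply (F (d \<sigma> k)) x) \<longlonglongrightarrow> l \<longrightarrow> blinfun_apply p x = l" for \<sigma>
    by (rule hahn_banach_limit[of "\<lambda>k. F (d \<sigma> k)" M]) (use bound in auto)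
  then obtain p :: "(nat \<Rightarrow> bool) \<Rightarrow> 'a \<Rightarrow>\<^sub>L real" where
    p: "\<And>\<sigma> x l. (\<lambda>k. blinfun_apply (F (d \<sigma> k)) x) \<longlonglongrightarrow> l \<Longrightarrow> blinfun_apply (p \<sigma>) x = l"
    by metis
  have "filterlim (d \<sigma>) at_top sequentially" for \<sigma>
    by (rule filterlim_at_top_mono[OF filterlim_ident]) (simp add: d_def N_ge)
  then have p_ann: "p \<sigma> \<in> annihilator Y" for \<sigma>
    unfolding annihilator_def using p filterlim_compose[OF null] by blast
  \<comment> \<open>At the node of depth \<open>m\<close>, the value of \<open>p \<sigma>\<close>
    records which child the branch takes there.\<close>
  have p_X: "blinfun_apply (p \<sigma>) (X (N (pre \<sigma> m))) = A (N (pre \<sigma> m)) (\<sigma> m)" for \<sigma> m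
  proof (rule p)
    define g where "g n = blinfun_apply (F (N (pre \<sigma> (Suc m)) n)) (X (N (pre \<sigma> m)))" for n
    have "g \<longlonglongrightarrow> A (N (pre \<sigma> m)) (\<sigma> m)"
      unfolding g_def pre_Suc N_Cons o_def by (rule A[OF N_ge])
    \<comment> \<open>The choice \<open>\<sigma> m\<close> takes effect at depth
      \<open>Suc m\<close>, so the diagonal follows the chosen child from index \<open>Suc m\<close>
      on.\<close>
    have "\<exists>w. \<forall>j. d \<sigma> (Suc m + j) = N (pre \<sigma> (Suc m)) (w j) \<and> j \<le> w j"
    proof -
      have "\<exists>i. d \<sigma> (Suc m + j) = N (pre \<sigma> (Suc m)) i \<and> j \<le> i" for j
      proof -
        obtain w where w: "N (pre \<sigma> (Suc m + j)) = N (pre \<sigma> (Suc m)) \<circ> w" "\<And>n. n \<le> w n"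
          using factor by blast
        then show ?thesis
          unfolding d_def by (intro exI[of _ "w (Suc m + j)"]) (simp add: order_trans[OF _ w(2)])
      qed
      then show ?thesis by metis
    qed
    then obtain w where w: "\<And>j. d \<sigma> (Suc m + j) = N (pre \<sigma> (Suc m)) (w j)" "\<And>j. j \<le> w j" by blast
    have "filterlim w at_top sequentially"
      by (rule filterlim_at_top_mono[OF filterlim_ident]) (simp add: w(2))
    then have "(\<lambda>j. g (w j)) \<longlonglongrightarrow> A (N (pre \<sigma> m)) (\<sigma> m)"
      by (rule filterlim_compose[OF \<open>g \<longlonglongrightarrow> _\<close>])
    then have "(\<lambda>j. blinfun_apply (F (d \<sigma> (j + Suc m))) (X (N (pre \<sigma> m)))) \<longlonglongrightarrow> A (N (pre \<sigma> m)) (\<sigma> m)"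
      unfolding g_def by (simp only: w(1)[symmetric] add.commute)
    then show "(\<lambda>k. blinfun_apply (F (d \<sigma> k)) (X (N (pre \<sigma> m)))) \<longlonglongrightarrow> A (N (pre \<sigma> m)) (\<sigma> m)"
      by (rule LIMSEQ_offset)
  qed
  obtain V where V: "countable V" "\<And>p \<delta>. p \<in> annihilator Y \<Longrightarrow> \<delta> > 0 \<Longrightarrow>
      \<exists>v\<in>V. \<forall>x\<in>range (\<lambda>s. X (N s)). \<bar>blinfun_apply p x - blinfun_apply v x\<bar> \<le> \<delta> * norm x"
    using annihilator_countable_approximation[OF Y refl, of "range (\<lambda>s. X (N s))"] by auto
  \<comment> \<open>With \<open>e / 3\<close>, two branches sharing an approximant would be within
    \<open>2 * e / 3\<close> at all splitting vectors, less than their separation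
    \<open>e\<close>.\<close>
  have "\<forall>\<sigma>. \<exists>v. v \<in> V \<and> (\<forall>s. \<bar>blinfun_apply (p \<sigma>) (X (N s)) - blinfun_apply v (X (N s))\<bar> \<le> e / 3)"
  proof
    fix \<sigma>
    obtain v where v: "v \<in> V" "\<And>s. \<bar>blinfun_apply (p \<sigma>) (X (N s)) - blinfun_apply v (X (N s))\<bar> \<le> e / 3 * norm (X (N s))"
      using V(2)[OF p_ann, of "e / 3" \<sigma>] \<open>e > 0\<close> by auto
    moreover have "e / 3 * norm (X (N s)) \<le> e / 3" for s
      using mult_left_mono[OF X[OF N_ge], of "e / 3"] \<open>e > 0\<close> by simp
    ultimately show "\<exists>v. v \<in> V \<and> (\<forall>s. \<bar>blinfun_apply (p \<sigma>) (X (N s)) - blinfun_apply v (X (N s))\<bar> \<le> e / 3)"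
      using order_trans by blast
  qed
  then obtain v where v: "\<And>\<sigma>. v \<sigma> \<in> V"
    "\<And>\<sigma> s. \<bar>blinfun_apply (p \<sigma>) (X (N s)) - blinfun_apply (v \<sigma>) (X (N s))\<bar> \<le> e / 3"
    unfolding choice_iff by blast
  \<comment> \<open>Two different branches share the node before their first disagreement
    \<open>m\<close>, and are separated at its splitting vector. So the uncountable set of branches
    embeds in \<open>V\<close>.\<close>
  have "inj v"
  proof (rule injI, rule ccontr)
    fix \<sigma> \<tau> assume eq: "v \<sigma> = v \<tau>" and "\<sigma> \<noteq> \<tau>"
    then obtain m where m: "\<sigma> m \<noteq> \<tau> m" "\<And>k. k < m \<Longrightarrow> \<sigma> k = \<tau> k"
      using exists_least_iff[of "\<lambda>m. \<sigma> m \<noteq> \<tau> m"] by blast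
    have same: "pre \<tau> m = pre \<sigma> m" using m(2) by (simp add: pre_def)
    let ?s = "pre \<sigma> m"
    have "e \<le> \<bar>A (N ?s) (\<sigma> m) - A (N ?s) (\<tau> m)\<bar>"
    proof -
      have "e \<le> \<bar>A (N ?s) True - A (N ?s) False\<bar>" by (rule sep[OF N_ge])
      then show ?thesis using m(1) by (cases "\<sigma> m"; cases "\<tau> m") auto
    qed
    also have "\<dots> = \<bar>blinfun_apply (p \<sigma>) (X (N ?s)) - blinfun_apply (p \<tau>) (X (N ?s))\<bar>"
      using p_X[of \<sigma> m] p_X[of \<tau> m] by (simp add: same)
    also have "\<dots> \<le> e / 3 + e / 3"
      using v(2)[of \<sigma> ?s] v(2)[of \<tau> ?s] unfolding eq by linarith
    finally show False using \<open>e > 0\<close> by simp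
  qed
  then have "countable (UNIV :: (nat \<Rightarrow> bool) set)"
    using v(1) V(1) by (metis countable_image_inj_eq countable_subset image_subset_iff)
  then show False using uncountable_binary_sequences by blast
qed

section \<open>Diagonal extraction\<close>

lemma ex_strict_mono_subseq:
  fixes r :: "nat \<Rightarrow> nat"
  assumes "\<And>n. n \<le> r n"
  obtains q :: "nat \<Rightarrow> nat" where "strict_mono q" "strict_mono (r \<circ> q)"
proof -
  \<comment> \<open>Each new index exceeds the previous value of \<open>r\<close>, so
    \<open>r (q (Suc n)) \<ge> q (Suc n) > r (q n)\<close>.\<close>
  define q where "q = rec_nat 0 (\<lambda>_ k. Suc (r k))"
  have q: "q (Suc n) = Suc (r (q n))" for n by (simp add: q_def)
  have "strict_mono q" using assms by (auto simp: strict_mono_Suc_iff q le_imp_less_Suc)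
  moreover have "strict_mono (r \<circ> q)"
    using assms by (auto simp: strict_mono_Suc_iff q Suc_le_eq[symmetric])
  ultimately show ?thesis by (rule that)
qed

text \<open>Subsequences of oscillation at most \<open>1 / Suc n\<close> are refined successively;
  their diagonal is Cauchy at every vector.\<close>

lemma ex_pointwise_convergent_subseq:
  fixes F :: "nat \<Rightarrow> 'a::banach \<Rightarrow>\<^sub>L real"
  assumes Y: "subspace Y" "closed Y"
    and refl: "\<And>\<Phi> :: ('a \<Rightarrow>\<^sub>L real) \<Rightarrow>\<^sub>L real.
      \<exists>x. \<forall>F\<in>annihilator Y. blinfun_apply \<Phi> F = blinfun_apply F x"
    and bound: "\<And>n. norm (F n) \<le> M"
    and null: "\<And>y. y \<in> Y \<Longrightarrow> (\<lambda>n. blinfun_apply (F n) y) \<longlonglongrightarrow> 0"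
  shows "\<exists>r. strict_mono r \<and> (\<forall>x. convergent (\<lambda>n. blinfun_apply (F (r n)) x))"
proof -
  interpret subseqs "\<lambda>n s. eventually_oscillates_at_most (1 / real (Suc n)) (F \<circ> s)"
  proof
    fix n and s :: "nat \<Rightarrow> nat" assume s: "strict_mono s"
    obtain r :: "nat \<Rightarrow> nat" where r: "\<And>n. n \<le> r n"
      "eventually_oscillates_at_most (1 / real (Suc n)) ((F \<circ> s) \<circ> r)"
    proof (rule ex_subseq_small_oscillation[OF Y refl, of "F \<circ> s" M "1 / real (Suc n)"])
      show "norm ((F \<circ> s) n) \<le> M" for n using bound by simp
      show "(\<lambda>n. blinfun_apply ((F \<circ> s) n) y) \<longlonglongrightarrow> 0" if "y \<in> Y" for y
        using LIMSEQ_subseq_LIMSEQ[OF null[OF that] s] by (simp add: o_def)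
    qed auto
    obtain q :: "nat \<Rightarrow> nat" where q: "strict_mono q" "strict_mono (r \<circ> q)" using ex_strict_mono_subseq r(1) by blast
    have "eventually_oscillates_at_most (1 / real (Suc n)) ((F \<circ> s \<circ> r) \<circ> q)"
      by (rule eventually_oscillates_at_most_compose[OF r(2) seq_suble[OF q(1)]])
    then show "\<exists>r'. strict_mono r' \<and> eventually_oscillates_at_most (1 / real (Suc n)) (F \<circ> (s \<circ> r'))"
      using q(2) by (intro exI[of _ "r \<circ> q"]) (simp add: o_assoc)
  qed
  \<comment> \<open>The diagonal is a refinement of stage \<open>k\<close> only after its first
    \<open>Suc k\<close> entries are dropped.\<close>
  have small: "eventually_oscillates_at_most (1 / real (Suc k)) (F \<circ> (diagseq \<circ> (+) (Suc k)))" for k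
    by (rule diagseq_holds)
      (use eventually_oscillates_at_most_compose seq_suble in \<open>metis o_assoc\<close>)
  have "Cauchy (\<lambda>n. blinfun_apply (F (diagseq n)) x)" for x
  proof (rule CauchyI)
    fix e :: real assume "e > 0"
    obtain k where k: "norm x * (1 / real (Suc k)) < e"
    proof -
      obtain k where "norm x / e < real (Suc k)"
        using reals_Archimedean2[of "norm x / e"] by (metis less_trans of_nat_less_iff lessI)
      then show ?thesis using that[of k] \<open>e > 0\<close> by (simp add: field_simps)
    qed
    \<comment> \<open>Oscillation is controlled on the unit ball only, so \<open>x\<close> is
      written as its norm times \<open>sgn x\<close>; this also covers \<open>x = 0\<close>.\<close>
    have unit: "norm (sgn x) \<le> 1" by (simp add: norm_sgn)
    let ?G = "F \<circ> (diagseq \<circ> (+) (Suc k))"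
    obtain N where N: "\<And>m n. m \<ge> N \<Longrightarrow> n \<ge> N \<Longrightarrow>
      \<bar>blinfun_apply (?G m) (sgn x) - blinfun_apply (?G n) (sgn x)\<bar> \<le> 1 / real (Suc k)"
      using eventually_oscillates_at_most_def[THEN iffD1, OF small[of k], rule_format, OF unit]
      by blast
    have x: "x = norm x *\<^sub>R sgn x" by (cases "x = 0") (simp_all add: sgn_div_norm)
    have lt: "\<bar>blinfun_apply (?G m) x - blinfun_apply (?G n) x\<bar> < e" if "m \<ge> N" "n \<ge> N" for m n
    proof -
      have "\<bar>blinfun_apply (?G m) x - blinfun_apply (?G n) x\<bar>
        = norm x * \<bar>blinfun_apply (?G m) (sgn x) - blinfun_apply (?G n) (sgn x)\<bar>"
        by (subst (1 2) x) (simp only: blinfun.scaleR_right real_scaleR_def abs_mult abs_norm_cancel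
            flip: right_diff_distrib)
      also have "\<dots> \<le> norm x * (1 / real (Suc k))" by (intro mult_left_mono N that) auto
      finally show ?thesis using k by simp
    qed
    show "\<exists>M. \<forall>m\<ge>M. \<forall>n\<ge>M. norm (blinfun_apply (F (diagseq m)) x - blinfun_apply (F (diagseq n)) x) < e"
    proof (intro exI[of _ "N + Suc k"] allI impI)
      fix m n assume "m \<ge> N + Suc k" "n \<ge> N + Suc k"
      then show "norm (blinfun_apply (F (diagseq m)) x - blinfun_apply (F (diagseq n)) x) < e"
        using lt[of "m - Suc k" "n - Suc k"] by simp
    qed
  qed
  then show ?thesis using subseq_diagseq Cauchy_convergent by blast
qed

section \<open>The theorem for real functionals\<close>

text \<open>A functional \<open>\<Phi>\<close> that kills the annihilator depends only on
  restrictions to \<open>Y\<close>, so it represents an element of the bidual of \<open>Y\<close>.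
  If convergence failed, a subsequence would stay \<open>e\<close> away; a further one converges
  pointwise on the whole space to some \<open>H\<close> that agrees with \<open>G\<close> on
  \<open>Y\<close>, and the Grothendieck property gives convergence to
  \<open>\<Phi> H = \<Phi> G\<close>.\<close>

lemma tendsto_of_annihilating_functional:
  fixes F :: "nat \<Rightarrow> 'a::banach \<Rightarrow>\<^sub>L real" and \<Phi> :: "('a \<Rightarrow>\<^sub>L real) \<Rightarrow>\<^sub>L real"
  assumes Y: "subspace Y" "closed Y"
    and refl: "\<And>\<Phi> :: ('a \<Rightarrow>\<^sub>L real) \<Rightarrow>\<^sub>L real.
      \<exists>x. \<forall>F\<in>annihilator Y. blinfun_apply \<Phi> F = blinfun_apply F x"
    and grothendieck: "\<And>(F :: nat \<Rightarrow> 'a \<Rightarrow>\<^sub>L real) G (\<Phi> :: ('a \<Rightarrow>\<^sub>L real) \<Rightarrow>\<^sub>L real).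
      (\<And>x. (\<lambda>n. blinfun_apply (F n) x) \<longlonglongrightarrow> blinfun_apply G x) \<Longrightarrow>
      (\<lambda>n. blinfun_apply \<Phi> (F n)) \<longlonglongrightarrow> blinfun_apply \<Phi> G"
    and bound: "\<And>n. norm (F n) \<le> M"
    and lim: "\<And>y. y \<in> Y \<Longrightarrow> (\<lambda>n. blinfun_apply (F n) y) \<longlonglongrightarrow> blinfun_apply G y"
    and \<Phi>: "\<And>H. H \<in> annihilator Y \<Longrightarrow> blinfun_apply \<Phi> H = 0"
  shows "(\<lambda>n. blinfun_apply \<Phi> (F n)) \<longlonglongrightarrow> blinfun_apply \<Phi> G"
proof (rule ccontr)
  assume "\<not> ?thesis"
  then obtain e where e: "e > 0"
    and "\<not> (\<forall>\<^sub>F n in sequentially. dist (blinfun_apply \<Phi> (F n)) (blinfun_apply \<Phi> G) < e)"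
    unfolding tendsto_iff by blast
  then have "\<exists>\<^sub>F n in sequentially. e \<le> dist (blinfun_apply \<Phi> (F n)) (blinfun_apply \<Phi> G)"
    by (simp add: frequently_def not_le)
  then have "infinite {n. e \<le> dist (blinfun_apply \<Phi> (F n)) (blinfun_apply \<Phi> G)}"
    by (simp add: frequently_cofinite flip: cofinite_eq_sequentially)
  then obtain s :: "nat \<Rightarrow> nat" where s: "strict_mono s"
    "\<And>n. e \<le> dist (blinfun_apply \<Phi> (F (s n))) (blinfun_apply \<Phi> G)"
    using infinite_enumerate by (metis (mono_tags, lifting) mem_Collect_eq)
  \<comment> \<open>Subtracting \<open>G\<close> makes the sequence null on \<open>Y\<close>, as the
    extraction of subsequences requires.\<close>
  have bound': "norm (F (s n) - G) \<le> M + norm G" for n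
    using norm_triangle_ineq4[of "F (s n)" G] bound[of "s n"] by simp
  have null: "(\<lambda>n. blinfun_apply (F (s n) - G) y) \<longlonglongrightarrow> 0" if "y \<in> Y" for y
    using LIM_zero[OF LIMSEQ_subseq_LIMSEQ[OF lim[OF that] s(1)]] by (simp add: o_def blinfun.diff_left)
  have "\<exists>r. strict_mono r \<and> (\<forall>x. convergent (\<lambda>n. blinfun_apply (F (s (r n)) - G) x))"
    by (rule ex_pointwise_convergent_subseq[OF Y refl bound' null])
  then obtain r where r: "strict_mono r"
    "\<And>x. convergent (\<lambda>n. blinfun_apply (F (s (r n)) - G) x)"
    by blast
  have conv: "convergent (\<lambda>n. blinfun_apply (F (s (r n))) x)" for x
    using convergent_add[OF r(2)[of x] convergent_const[of "blinfun_apply G x"]]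
    by (simp add: blinfun.diff_left)
  obtain H :: "'a \<Rightarrow>\<^sub>L real" where
    H: "\<And>x l. (\<lambda>n. blinfun_apply (F (s (r n))) x) \<longlonglongrightarrow> l \<Longrightarrow> blinfun_apply H x = l"
    using hahn_banach_limit[of "\<lambda>n. F (s (r n))" M] bound by metis
  have "(\<lambda>n. blinfun_apply (F (s (r n))) x) \<longlonglongrightarrow> blinfun_apply H x" for x
    using conv[of x] H unfolding convergent_def by blast
  then have weak: "(\<lambda>n. blinfun_apply \<Phi> (F (s (r n)))) \<longlonglongrightarrow> blinfun_apply \<Phi> H"
    by (rule grothendieck)
  have "H - G \<in> annihilator Y"
  proof -
    have "blinfun_apply H y = blinfun_apply G y" if "y \<in> Y" for y
      using LIMSEQ_subseq_LIMSEQ[OF LIMSEQ_subseq_LIMSEQ[OF lim[OF that] s(1)] r(1)]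
      by (intro H) (simp add: o_def)
    then show ?thesis by (simp add: annihilator_def blinfun.diff_left)
  qed
  then have "blinfun_apply \<Phi> H = blinfun_apply \<Phi> G"
    using \<Phi> by (force simp: blinfun.diff_right)
  then have "(\<lambda>n. dist (blinfun_apply \<Phi> (F (s (r n)))) (blinfun_apply \<Phi> G)) \<longlonglongrightarrow> 0"
    using weak tendsto_dist_iff by metis
  then have "e \<le> 0" by (rule LIMSEQ_le_const) (use s(2) in auto)
  then show False using e by simp
qed

section \<open>From real functionals to functionals over the scalar field\<close>

text \<open>For real scalars \<open>j\<close> is \<open>0\<close>, for complex ones the imaginary unit, so that the decomposition covers both.\<close>

locale real_part =
  fixes re :: "'k::real_normed_field \<Rightarrow> real" and j :: 'k
  assumes re_add: "re (z + w) = re z + re w"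
    and re_scaleR: "re (t *\<^sub>R z) = t * re z"
    and re_of_real: "re (of_real t) = t"
    and re_j: "re (j * of_real t) = 0"
    and abs_re_le: "\<bar>re z\<bar> \<le> norm z"
    and decomposition: "z = of_real (re z) - j * of_real (re (j * z))"
    and j_square: "j * j = - 1 \<or> j = 0"
begin

lemma re_diff: "re (z - w) = re z - re w"
  using re_add[of "z - w" w] by simp

lemma bounded_linear_re: "bounded_linear re"
  by (rule bounded_linear_intro[of re 1]) (auto simp: re_add re_scaleR abs_re_le)

lemma re_mult: "re (c * z) = re c * re z - re (j * c) * re (j * z)"
proof -
  have "c * z = re c *\<^sub>R z - re (j * c) *\<^sub>R (j * z)"
    by (subst decomposition[of c]) (simp add: scaleR_conv_of_real algebra_simps)
  then show ?thesis by (simp add: re_diff re_scaleR)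
qed

text \<open>Here \<open>u c\<close> stands for a real-linear functional at \<open>c\<close> times a
  fixed vector, expanded in the real coordinates \<open>re c\<close> and \<open>- re (j * c)\<close>
  of \<open>c\<close>. It serves for functionals on the space and again on the dual.\<close>

lemma scalar_extension:
  assumes u: "\<And>c. u c = re c * u 1 - re (j * c) * u j"
  shows "of_real (u c) - j * of_real (u (j * c)) = c * (of_real (u 1) - j * of_real (u j))"
  using j_square
proof
  assume j: "j * j = - 1"
  then have jj: "j * (j * z) = - z" for z by (simp flip: mult.assoc)
  moreover have "re (- c) = - re c" using re_scaleR[of "-1" c] by simp
  ultimately have ujc: "u (j * c) = re (j * c) * u 1 + re c * u j" using u[of "j * c"] by simp
  then have "of_real (u c) - j * of_real (u (j * c))
    = (of_real (re c) - j * of_real (re (j * c))) * of_real (u 1)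
      - (of_real (re (j * c)) + j * of_real (re c)) * of_real (u j)"
    by (subst (1) u[of c]) (simp add: ujc algebra_simps)
  also have "of_real (re (j * c)) + j * of_real (re c)
    = (of_real (re c) - j * of_real (re (j * c))) * j"
    by (simp add: algebra_simps jj)
  finally show ?thesis unfolding decomposition[of c, symmetric] by (simp add: algebra_simps)
next
  assume "j = 0"
  moreover have "re 0 = 0" using re_of_real[of 0] by simp
  ultimately show ?thesis using u[of c] decomposition[of c] by simp
qed

end

text \<open>For real scalars \<open>re\<close> inverts \<open>of_real\<close>. Otherwise
  \<open>re\<close> is the first coordinate with respect to \<open>1\<close> and \<open>i\<close>,
  which is well defined because \<open>i\<close> is no real multiple of 1.\<close>

lemma ex_real_part:
  obtains re :: "'k::real_or_complex_field \<Rightarrow> real" and j where "real_part re j"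
proof -
  consider (real) "\<forall>z::'k. \<exists>a. z = a *\<^sub>R 1"
    | (complex) i :: 'k where "i * i = - 1"
      "\<And>z. \<exists>a b. z = a *\<^sub>R 1 + b *\<^sub>R i \<and> norm z = sqrt (a\<^sup>2 + b\<^sup>2)"
    using real_or_complex[where 'a = 'k] by blast
  then show ?thesis
  proof cases
    case real
    then obtain re :: "'k \<Rightarrow> real" where re: "\<And>z. z = of_real (re z)"
      unfolding of_real_def by metis
    have re_of_real: "re (of_real t) = t" for t using re[of "of_real t"] by (simp only: of_real_eq_iff)
    have "real_part re 0"
    proof
      show "re (z + w) = re z + re w" for z w
        using re re_of_real by (metis of_real_add)
      show "re (t *\<^sub>R z) = t * re z" for t z
        using re re_of_real by (metis scaleR_conv_of_real of_real_mult)
      show "\<bar>re z\<bar> \<le> norm z" for z using re[of z] by (metis norm_of_real order_refl)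
      show "re (0 * of_real t) = 0" for t using re_of_real[of 0] by simp
    qed (use re re_of_real in auto)
    then show ?thesis by (rule that)
  next
    case complex
    have "\<forall>z. \<exists>a b. z = of_real a + of_real b * i \<and> norm z = sqrt (a\<^sup>2 + b\<^sup>2)"
      using complex(2) by (simp add: scaleR_conv_of_real)
    then obtain re im where "\<forall>z. z = of_real (re z) + of_real (im z) * i \<and>
        norm z = sqrt ((re z)\<^sup>2 + (im z)\<^sup>2)"
      unfolding choice_iff by blast
    then have rep: "\<And>z. z = of_real (re z) + of_real (im z) * i"
      "\<And>z. norm z = sqrt ((re z)\<^sup>2 + (im z)\<^sup>2)" by auto
    have not_real: "i \<noteq> of_real t" for t
    proof
      assume "i = of_real t"
      then have "of_real (t * t) = (of_real (- 1) :: 'k)" using complex(1) by simp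
      then have "t * t = - 1" by (simp only: of_real_eq_iff)
      then show False using zero_le_square[of t] by simp
    qed
    have uniq: "a = c \<and> b = d" if "of_real a + of_real b * i = (of_real c + of_real d * i :: 'k)" for a b c d
    proof -
      have eq: "of_real (b - d) * i = (of_real (c - a) :: 'k)" using that by (simp add: algebra_simps)
      have "b = d"
      proof (rule ccontr)
        assume "b \<noteq> d"
        then have "i = of_real ((c - a) / (b - d))"
          using eq by (simp add: nonzero_eq_divide_eq mult.commute)
        then show False using not_real by blast
      qed
      then show ?thesis using that by simp
    qed
    have re: "re (of_real a + of_real b * i) = a" for a b
      using uniq rep(1)[of "of_real a + of_real b * i"] by metis
    have "real_part re i"
    proof
      show "re (z + w) = re z + re w" for z w
      proof -
        have "z + w = of_real (re z + re w) + of_real (im z + im w) * i"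
          by (subst rep(1)[of z], subst rep(1)[of w]) (simp add: algebra_simps)
        then show ?thesis using re by metis
      qed
      show "re (t *\<^sub>R z) = t * re z" for t z
      proof -
        have "t *\<^sub>R z = of_real (t * re z) + of_real (t * im z) * i"
          by (subst rep(1)[of z]) (simp add: scaleR_conv_of_real algebra_simps)
        then show ?thesis using re by metis
      qed
      show "re (of_real t) = t" for t using re[of t 0] by simp
      show "re (i * of_real t) = 0" for t using re[of 0 t] by (simp add: mult.commute)
      show "\<bar>re z\<bar> \<le> norm z" for z using rep(2)[of z] by (simp add: real_le_rsqrt)
      show "z = of_real (re z) - i * of_real (re (i * z))" for z
      proof -
        have "i * z = of_real (re z) * i + of_real (im z) * (i * i)"
          by (subst rep(1)[of z]) (simp add: algebra_simps)
        also have "\<dots> = of_real (- im z) + of_real (re z) * i" by (simp add: complex(1))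
        finally have "re (i * z) = - im z" using re by metis
        then show ?thesis using rep(1)[of z] by (simp add: mult.commute)
      qed
      show "i * i = - 1 \<or> i = 0" using complex(1) by blast
    qed
    then show ?thesis by (rule that)
  qed
qed

section \<open>Scalar functionals from real ones\<close>

locale scalar_banach_space = banach_space_over sc + real_part re j
  for sc :: "'k::real_or_complex_field \<Rightarrow> 'a::banach \<Rightarrow> 'a" and re :: "'k \<Rightarrow> real" and j :: 'k
begin

text \<open>The classical formula \<open>F x - i * F (i x)\<close> for the scalar-linear functional
  with real part \<open>F\<close>; for \<open>j = 0\<close> it is \<open>F\<close> itself.\<close>

definition scalar_functional :: "('a \<Rightarrow>\<^sub>L real) \<Rightarrow> 'a \<Rightarrow> 'k" where
  "scalar_functional F x = of_real (blinfun_apply F x) - j * of_real (blinfun_apply F (sc j x))"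

lemma scalar_functional_add: "scalar_functional F (x + y) = scalar_functional F x + scalar_functional F y"
  by (simp add: scalar_functional_def scale_right_distrib blinfun.add_right algebra_simps)

lemma scale_decomposition: "sc c x = re c *\<^sub>R x - re (j * c) *\<^sub>R sc j x"
proof -
  have "sc c x = sc (of_real (re c) - of_real (re (j * c)) * j) x"
    by (subst decomposition[of c]) (simp add: mult.commute)
  then show ?thesis
    unfolding scale_left_diff_distrib scale_scale[symmetric] scale_of_real .
qed

lemma scalar_functional_scale: "scalar_functional F (sc c x) = c * scalar_functional F x"
proof -
  have "blinfun_apply F (sc c x) = re c * blinfun_apply F (sc 1 x) - re (j * c) * blinfun_apply F (sc j x)" for c
    by (subst scale_decomposition) (simp add: blinfun.diff_right blinfun.scaleR_right)
  from scalar_extension[of "\<lambda>c. blinfun_apply F (sc c x)" c, OF this]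
  show ?thesis by (simp add: scalar_functional_def)
qed

lemma re_scalar_functional: "re (scalar_functional F x) = blinfun_apply F x"
  by (simp add: scalar_functional_def re_diff re_of_real re_j)

text \<open>The factor is 1 or 2. This crude bound suffices, since only boundedness of the
  functional is wanted.\<close>

lemma norm_scalar_functional_le:
  "norm (scalar_functional F x) \<le> (norm F * (1 + norm j * norm j)) * norm x"
proof -
  have "norm (scalar_functional F x) \<le> \<bar>blinfun_apply F x\<bar> + norm j * \<bar>blinfun_apply F (sc j x)\<bar>"
    unfolding scalar_functional_def
    by (rule order_trans[OF norm_triangle_ineq4]) (simp add: norm_mult)
  also have "\<dots> \<le> norm F * norm x + norm j * (norm F * norm (sc j x))"
    using norm_blinfun[of F x] norm_blinfun[of F "sc j x"]
    by (intro add_mono mult_left_mono) auto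
  finally show ?thesis by (simp add: norm_scale algebra_simps)
qed

lemma scalar_functional_eqI:
  assumes "\<And>c. f (sc c x) = c * f x"
    and "\<And>c. blinfun_apply F (sc c x) = re (f (sc c x))"
  shows "scalar_functional F x = f x"
  using assms(2)[of 1] assms(2)[of j] assms(1)[of j] decomposition[of "f x"]
  by (simp add: scalar_functional_def)

end

section \<open>Duals and biduals of represented spaces\<close>

lemma mem_dual_iff:
  "f \<in> vecs (dual Z) \<longleftrightarrow>
    (\<forall>x\<in>vecs Z. \<forall>y\<in>vecs Z. f (vadd Z x y) = f x + f y) \<and>
    (\<forall>c. \<forall>x\<in>vecs Z. f (vscale Z c x) = c * f x) \<and>
    (\<exists>B. \<forall>x\<in>vecs Z. norm (f x) \<le> B * vnorm Z x) \<and>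
    (\<forall>x. x \<notin> vecs Z \<longrightarrow> f x = 0)"
  by (simp add: dual_def)

lemma dual_simps:
  "vadd (dual Z) f g = (\<lambda>x. f x + g x)" "vscale (dual Z) c f = (\<lambda>x. c * f x)"
  "vnorm (dual Z) f = Sup {norm (f x) | x. x \<in> vecs Z \<and> vnorm Z x \<le> 1}"
  by (simp_all add: dual_def)

lemma subspace_nspace_simps:
  "vecs (subspace_nspace sc Y) = Y" "vadd (subspace_nspace sc Y) = (+)"
  "vscale (subspace_nspace sc Y) = sc" "vnorm (subspace_nspace sc Y) = norm"
  by (simp_all add: subspace_nspace_def)

text \<open>Covers the identity of the whole space and the projection onto the quotient by \<open>Y\<close>.\<close>

locale quotient_map = scalar_banach_space sc re j
  for sc :: "'k::real_or_complex_field \<Rightarrow> 'a::banach \<Rightarrow> 'a" and re :: "'k \<Rightarrow> real" and j :: 'k +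
  fixes Z :: "('k, 'v) nspace" and pr :: "'a \<Rightarrow> 'v"
  assumes pr_in: "pr x \<in> vecs Z"
    and pr_add: "pr (x + y) = vadd Z (pr x) (pr y)"
    and pr_scale: "pr (sc c x) = vscale Z c (pr x)"
    and norm_pr_le: "vnorm Z (pr x) \<le> norm x"
    and pr_lift: "v \<in> vecs Z \<Longrightarrow> 0 < e \<Longrightarrow> \<exists>x. pr x = v \<and> norm x < vnorm Z v + e"
begin

lemma vecs_eq: "vecs Z = range pr"
  using pr_in pr_lift[OF _ zero_less_one] by blast

lemma vnorm_nonneg: "v \<in> vecs Z \<Longrightarrow> 0 \<le> vnorm Z v"
proof (rule field_le_epsilon)
  fix e :: real assume "v \<in> vecs Z" "0 < e"
  then obtain x :: 'a where "norm x < vnorm Z v + e" using pr_lift[of v e] by auto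
  then show "0 \<le> vnorm Z v + e" using norm_ge_zero[of x] by linarith
qed

context
  fixes h assumes h: "h \<in> vecs (dual Z)"
begin

lemma dual_pr_add: "h (pr (x + y)) = h (pr x) + h (pr y)"
  using h pr_in by (simp add: mem_dual_iff pr_add)

lemma dual_pr_scale: "h (pr (sc c x)) = c * h (pr x)"
  using h pr_in by (simp add: mem_dual_iff pr_scale)

lemma dual_pr_le: "norm (h (pr x)) \<le> vnorm (dual Z) h * norm x"
proof (cases "x = 0")
  case True
  then show ?thesis using dual_pr_scale[of 0 0] by simp
next
  case False
  obtain B where B: "\<And>v. v \<in> vecs Z \<Longrightarrow> norm (h v) \<le> B * vnorm Z v"
    using h unfolding mem_dual_iff by blast
  have "norm (h v) \<le> \<bar>B\<bar>" if "v \<in> vecs Z" "vnorm Z v \<le> 1" for v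
  proof -
    have "norm (h v) \<le> \<bar>B\<bar> * vnorm Z v"
      using B[OF that(1)] mult_right_mono[OF abs_ge_self vnorm_nonneg[OF that(1)]] by (rule order_trans)
    also have "\<dots> \<le> \<bar>B\<bar>" using mult_left_mono[OF that(2) abs_ge_zero] by simp
    finally show ?thesis .
  qed
  \<comment> \<open>A supremum is meaningful only for a set bounded above. The sign of
    \<open>B\<close> is unknown, hence its absolute value.\<close>
  then have bdd: "bdd_above {norm (h v) | v. v \<in> vecs Z \<and> vnorm Z v \<le> 1}"
    by (intro bdd_aboveI[of _ "\<bar>B\<bar>"]) blast
  let ?u = "sc (of_real (1 / norm x)) x"
  have "norm ?u = 1" using False by (simp add: norm_scale norm_divide)
  then have "vnorm Z (pr ?u) \<le> 1" using norm_pr_le[of ?u] by simp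
  then have "norm (h (pr ?u)) \<le> vnorm (dual Z) h"
    unfolding dual_simps using pr_in by (intro cSup_upper[OF _ bdd]) blast
  then show ?thesis using False by (simp add: dual_pr_scale norm_mult norm_divide field_simps)
qed

end

text \<open>Pulling back along \<open>pr\<close> carries the dual of \<open>Z\<close> into the type
  of bounded real functionals, where the analysis takes place.\<close>

definition real_functional :: "('v \<Rightarrow> 'k) \<Rightarrow> 'a \<Rightarrow>\<^sub>L real" where
  "real_functional h = Blinfun (\<lambda>x. re (h (pr x)))"

lemma real_functional:
  assumes h: "h \<in> vecs (dual Z)"
  shows real_functional_apply: "blinfun_apply (real_functional h) x = re (h (pr x))"
    and norm_real_functional_le: "norm (real_functional h) \<le> vnorm (dual Z) h"
proof -
  have "\<bar>re (h (pr x))\<bar> \<le> vnorm (dual Z) h * norm x" for x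
    using abs_re_le dual_pr_le[OF h] by (rule order_trans)
  note bd = this
  have "bounded_linear (\<lambda>x. re (h (pr x)))"
  proof (rule bounded_linear_intro[of _ "vnorm (dual Z) h"])
    show "re (h (pr (t *\<^sub>R x))) = t *\<^sub>R re (h (pr x))" for t x
      using dual_pr_scale[OF h, of "of_real t" x]
      by (simp add: scale_of_real re_scaleR flip: scaleR_conv_of_real)
  qed (use bd in \<open>auto simp: dual_pr_add[OF h] re_add mult.commute\<close>)
  then have ap: "blinfun_apply (real_functional h) = (\<lambda>x. re (h (pr x)))"
    unfolding real_functional_def by (rule bounded_linear_Blinfun_apply)
  then show "blinfun_apply (real_functional h) x = re (h (pr x))" by simp
  show "norm (real_functional h) \<le> vnorm (dual Z) h"
  proof (rule norm_blinfun_bound)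
    \<comment> \<open>In the zero space there is no nonzero vector to test with, but the supremum is
      then over a single norm.\<close>
    show "0 \<le> vnorm (dual Z) h"
    proof (cases "\<exists>x::'a. x \<noteq> 0")
      case True
      then obtain x :: 'a where "x \<noteq> 0" by blast
      then show ?thesis using bd[of x] abs_ge_zero[of "re (h (pr x))"]
        by (smt (verit, best) mult_neg_pos zero_less_norm_iff)
    next
      case False
      then have "pr x = pr 0" for x by metis
      then have "vecs Z = {pr 0}" unfolding vecs_eq by auto
      moreover have "vnorm Z (pr 0) \<le> 1" using norm_pr_le[of 0] by simp
      ultimately have "{norm (h v) | v. v \<in> vecs Z \<and> vnorm Z v \<le> 1} = {norm (h (pr 0))}" by auto
      then show ?thesis unfolding dual_simps by simp
    qed
  qed (use bd in \<open>simp add: ap\<close>)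
qed

lemma scale_mem_dual:
  assumes "h \<in> vecs (dual Z)"
  shows "(\<lambda>v. c * h v) \<in> vecs (dual Z)"
  unfolding mem_dual_iff
proof (intro conjI)
  obtain B where B: "\<And>v. v \<in> vecs Z \<Longrightarrow> norm (h v) \<le> B * vnorm Z v"
    using assms unfolding mem_dual_iff by blast
  show "\<exists>B. \<forall>v\<in>vecs Z. norm (c * h v) \<le> B * vnorm Z v"
    using mult_left_mono[OF B norm_ge_zero[of c]]
    by (intro exI[of _ "norm c * B"]) (simp add: norm_mult mult.assoc)
qed (use assms in \<open>auto simp: mem_dual_iff algebra_simps\<close>)

lemma add_mem_dual:
  assumes "h \<in> vecs (dual Z)" "k \<in> vecs (dual Z)"
  shows "(\<lambda>v. h v + k v) \<in> vecs (dual Z)"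
  unfolding mem_dual_iff
proof (intro conjI)
  obtain B C where B: "\<And>v. v \<in> vecs Z \<Longrightarrow> norm (h v) \<le> B * vnorm Z v"
    and C: "\<And>v. v \<in> vecs Z \<Longrightarrow> norm (k v) \<le> C * vnorm Z v"
    using assms unfolding mem_dual_iff by meson
  show "\<exists>B. \<forall>v\<in>vecs Z. norm (h v + k v) \<le> B * vnorm Z v"
    using norm_triangle_mono[OF B C] by (intro exI[of _ "B + C"]) (simp add: distrib_right)
qed (use assms in \<open>auto simp: mem_dual_iff algebra_simps\<close>)

lemma real_functional_add:
  assumes "h \<in> vecs (dual Z)" "k \<in> vecs (dual Z)"
  shows "real_functional (\<lambda>v. h v + k v) = real_functional h + real_functional k"
  by (rule blinfun_eqI)
    (simp add: assms add_mem_dual real_functional_apply blinfun.add_left re_add)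

lemma real_functional_scale:
  assumes "h \<in> vecs (dual Z)"
  shows "real_functional (\<lambda>v. c * h v)
    = re c *\<^sub>R real_functional h - re (j * c) *\<^sub>R real_functional (\<lambda>v. j * h v)"
  by (rule blinfun_eqI)
    (simp add: assms scale_mem_dual real_functional_apply blinfun.diff_left blinfun.scaleR_left re_mult[of c])

text \<open>Composing \<open>\<Phi>\<close> with \<open>real_functional\<close> gives a real-linear
  map on the dual of \<open>Z\<close>; the formula for \<open>scalar_functional\<close>, applied one
  level up, makes it scalar-linear.\<close>

lemma ex_bidual_of_real:
  fixes \<Phi> :: "('a \<Rightarrow>\<^sub>L real) \<Rightarrow>\<^sub>L real"
  obtains \<Psi> where "\<Psi> \<in> vecs (dual (dual Z))"
    "\<And>h. h \<in> vecs (dual Z) \<Longrightarrow> re (\<Psi> h) = blinfun_apply \<Phi> (real_functional h)"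
proof -
  define \<phi> where "\<phi> h = blinfun_apply \<Phi> (real_functional h)" for h
  define \<Psi> where "\<Psi> h = (if h \<in> vecs (dual Z)
    then of_real (\<phi> h) - j * of_real (\<phi> (\<lambda>v. j * h v)) else 0)" for h
  have \<phi>_add: "\<phi> (\<lambda>v. h v + k v) = \<phi> h + \<phi> k" if "h \<in> vecs (dual Z)" "k \<in> vecs (dual Z)" for h k
    using that by (simp add: \<phi>_def real_functional_add blinfun.add_right)
  have \<phi>_scale: "\<phi> (\<lambda>v. c * h v) = re c * \<phi> h - re (j * c) * \<phi> (\<lambda>v. j * h v)"
    if "h \<in> vecs (dual Z)" for c h
    using that by (simp add: \<phi>_def real_functional_scale[of _ c] blinfun.diff_right blinfun.scaleR_right)
  have \<phi>_le: "\<bar>\<phi> h\<bar> \<le> norm \<Phi> * vnorm (dual Z) h" if "h \<in> vecs (dual Z)" for h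
    unfolding \<phi>_def
    using norm_blinfun[of \<Phi> "real_functional h"]
      mult_left_mono[OF norm_real_functional_le[OF that] norm_ge_zero[of \<Phi>]] by simp
  have norm_j: "norm (real_functional (\<lambda>v. j * h v)) \<le> norm j * vnorm (dual Z) h"
    if h: "h \<in> vecs (dual Z)" for h
  proof (rule norm_blinfun_bound)
    show "0 \<le> norm j * vnorm (dual Z) h"
      using order_trans[OF norm_ge_zero norm_real_functional_le[OF h]] by simp
    show "norm (blinfun_apply (real_functional (\<lambda>v. j * h v)) x) \<le> norm j * vnorm (dual Z) h * norm x" for x
      using order_trans[OF abs_re_le, of "j * h (pr x)"] mult_left_mono[OF dual_pr_le[OF h, of x] norm_ge_zero[of j]]
      by (simp add: real_functional_apply[OF scale_mem_dual[OF h]] norm_mult mult.assoc)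
  qed
  have "\<Psi> \<in> vecs (dual (dual Z))"
    unfolding mem_dual_iff[of \<Psi>] dual_simps(1,2)
  proof (intro conjI ballI allI impI)
    fix h k assume h: "h \<in> vecs (dual Z)" and k: "k \<in> vecs (dual Z)"
    have "\<phi> (\<lambda>v. j * (h v + k v)) = \<phi> (\<lambda>v. j * h v) + \<phi> (\<lambda>v. j * k v)"
      using \<phi>_add[OF scale_mem_dual[OF h] scale_mem_dual[OF k]] by (simp add: distrib_left)
    then show "\<Psi> (\<lambda>v. h v + k v) = \<Psi> h + \<Psi> k"
      using h k by (simp add: \<Psi>_def add_mem_dual \<phi>_add algebra_simps)
  next
    fix c h assume h: "h \<in> vecs (dual Z)"
    show "\<Psi> (\<lambda>v. c * h v) = c * \<Psi> h"
    proof -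
      \<comment> \<open>The factor 1 is written out to match the term \<open>u 1\<close> in
        \<open>scalar_extension\<close>.\<close>
      have "\<phi> (\<lambda>v. c * h v) = re c * \<phi> (\<lambda>v. 1 * h v) - re (j * c) * \<phi> (\<lambda>v. j * h v)" for c
        unfolding mult_1_left by (rule \<phi>_scale[OF h])
      from scalar_extension[of "\<lambda>c. \<phi> (\<lambda>v. c * h v)" c, OF this]
      show ?thesis using h by (simp add: \<Psi>_def scale_mem_dual mult.assoc)
    qed
  next
    show "\<exists>B. \<forall>h\<in>vecs (dual Z). norm (\<Psi> h) \<le> B * vnorm (dual Z) h"
    proof (intro exI[of _ "norm \<Phi> * (1 + norm j * norm j)"] ballI)
      fix h assume h: "h \<in> vecs (dual Z)"
      have "\<bar>\<phi> (\<lambda>v. j * h v)\<bar> \<le> norm \<Phi> * (norm j * vnorm (dual Z) h)"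
        unfolding \<phi>_def using norm_blinfun[of \<Phi> "real_functional (\<lambda>v. j * h v)"]
          mult_left_mono[OF norm_j[OF h] norm_ge_zero[of \<Phi>]] by simp
      then have "norm j * \<bar>\<phi> (\<lambda>v. j * h v)\<bar> \<le> norm j * (norm \<Phi> * (norm j * vnorm (dual Z) h))"
        by (rule mult_left_mono) simp
      moreover have "norm (\<Psi> h) \<le> \<bar>\<phi> h\<bar> + norm j * \<bar>\<phi> (\<lambda>v. j * h v)\<bar>"
        using norm_triangle_ineq4[of "of_real (\<phi> h)" "j * of_real (\<phi> (\<lambda>v. j * h v))"] h
        by (simp add: \<Psi>_def norm_mult)
      ultimately show "norm (\<Psi> h) \<le> norm \<Phi> * (1 + norm j * norm j) * vnorm (dual Z) h"
        using \<phi>_le[OF h] by (simp add: algebra_simps)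
    qed
  qed (simp add: \<Psi>_def)
  moreover have "re (\<Psi> h) = blinfun_apply \<Phi> (real_functional h)" if "h \<in> vecs (dual Z)" for h
    using that by (simp add: \<Psi>_def re_diff re_of_real re_j \<phi>_def)
  ultimately show ?thesis by (rule that)
qed

text \<open>A functional constant on the fibres of \<open>pr\<close> factors through
  \<open>Z\<close>. So does its scalar version, because multiplication by \<open>j\<close> maps
  fibres into fibres.\<close>

lemma ex_dual_of_real:
  fixes F :: "'a \<Rightarrow>\<^sub>L real"
  assumes F: "\<And>x y. pr x = pr y \<Longrightarrow> blinfun_apply F x = blinfun_apply F y"
  obtains h where "h \<in> vecs (dual Z)" "\<And>x. h (pr x) = scalar_functional F x" "real_functional h = F"
proof -
  define h where "h v = (if v \<in> vecs Z then scalar_functional F (SOME x. pr x = v) else 0)" for v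
  have h_pr: "h (pr x) = scalar_functional F x" for x
  proof -
    define y where "y = (SOME y. pr y = pr x)"
    have y: "pr y = pr x" unfolding y_def by (rule someI[of _ x]) simp
    then have "pr (sc j y) = pr (sc j x)" by (simp add: pr_scale)
    then show ?thesis using F[OF y] F[of "sc j y" "sc j x"] pr_in
      by (simp add: h_def scalar_functional_def flip: y_def)
  qed
  have h: "h \<in> vecs (dual Z)"
    unfolding mem_dual_iff
  proof (intro conjI)
    show "\<forall>v\<in>vecs Z. \<forall>w\<in>vecs Z. h (vadd Z v w) = h v + h w"
      unfolding vecs_eq by (auto simp: h_pr scalar_functional_add simp flip: pr_add)
    show "\<forall>c. \<forall>v\<in>vecs Z. h (vscale Z c v) = c * h v"
      unfolding vecs_eq by (auto simp: h_pr scalar_functional_scale simp flip: pr_scale)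
    define C where "C = norm F * (1 + norm j * norm j)"
    have "0 \<le> C" by (simp add: C_def)
    have "norm (h v) \<le> C * vnorm Z v" if v: "v \<in> vecs Z" for v
    proof (rule field_le_epsilon)
      fix e :: real assume "e > 0"
      \<comment> \<open>Lifts attain the norm of \<open>v\<close> only approximately; this
        \<open>d\<close> keeps \<open>C * d \<le> e\<close>, also for \<open>C = 0\<close>.\<close>
      define d where "d = e / (C + 1)"
      have d: "d > 0" "C * d \<le> e" using \<open>e > 0\<close> \<open>0 \<le> C\<close> by (simp_all add: d_def field_simps)
      obtain x where x: "pr x = v" "norm x < vnorm Z v + d" using pr_lift[OF v d(1)] by blast
      have "norm (h v) \<le> C * norm x"
        using norm_scalar_functional_le[of F x] by (simp add: C_def h_pr flip: x(1))
      also have "\<dots> \<le> C * (vnorm Z v + d)" using x(2) \<open>0 \<le> C\<close> by (intro mult_left_mono) auto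
      finally show "norm (h v) \<le> C * vnorm Z v + e" using d(2) by (simp add: distrib_left)
    qed
    then show "\<exists>B. \<forall>v\<in>vecs Z. norm (h v) \<le> B * vnorm Z v" by blast
  qed (simp add: h_def)
  moreover have "real_functional h = F"
    by (rule blinfun_eqI) (simp add: real_functional_apply[OF h] h_pr re_scalar_functional)
  ultimately show ?thesis using h_pr that[of h] by simp
qed

lemma reflexive_nspace_real:
  fixes \<Phi> :: "('a \<Rightarrow>\<^sub>L real) \<Rightarrow>\<^sub>L real"
  assumes "reflexive_nspace Z"
  shows "\<exists>x. \<forall>F. (\<forall>x y. pr x = pr y \<longrightarrow> blinfun_apply F x = blinfun_apply F y) \<longrightarrow>
    blinfun_apply \<Phi> F = blinfun_apply F x"
proof -
  obtain \<Psi> where \<Psi>: "\<Psi> \<in> vecs (dual (dual Z))"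
    "\<And>h. h \<in> vecs (dual Z) \<Longrightarrow> re (\<Psi> h) = blinfun_apply \<Phi> (real_functional h)"
    using ex_bidual_of_real by blast
  then obtain v where "v \<in> vecs Z" "\<Psi> = canonical_embedding Z v"
    using assms unfolding reflexive_nspace_def by blast
  then obtain x where x: "\<Psi> = canonical_embedding Z (pr x)"
    unfolding vecs_eq by blast
  have "blinfun_apply \<Phi> F = blinfun_apply F x"
    if F: "\<And>x y. pr x = pr y \<Longrightarrow> blinfun_apply F x = blinfun_apply F y" for F
  proof -
    obtain h where h: "h \<in> vecs (dual Z)" "real_functional h = F"
      using ex_dual_of_real[OF F] by blast
    then show ?thesis
      using \<Psi>(2)[OF h(1)] real_functional_apply[OF h(1), of x] by (simp add: x canonical_embedding_def)
  qed
  then show ?thesis by blast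
qed

end

section \<open>Transfer of the hypotheses on the whole space and the quotient\<close>

context scalar_banach_space
begin

lemma quotient_map_whole: "quotient_map sc re j (whole_nspace sc) id"
  by unfold_locales (auto simp: subspace_nspace_simps)

lemma quotient_map_quotient:
  assumes Y: "module.subspace sc Y"
  shows "quotient_map sc re j (quotient_nspace sc Y) (\<lambda>x. (\<lambda>y. x + y) ` Y)"
proof -
  have Y0: "0 \<in> Y" and Yadd: "\<And>x y. x \<in> Y \<Longrightarrow> y \<in> Y \<Longrightarrow> x + y \<in> Y"
    and Yscale: "\<And>c x. x \<in> Y \<Longrightarrow> sc c x \<in> Y"
    using Y unfolding subspace_def by auto
  show ?thesis
  proof
    fix x y c
    show "(\<lambda>y. x + y) ` Y \<in> vecs (quotient_nspace sc Y)"
      by (auto simp: quotient_nspace_def)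
    show "(\<lambda>z. x + y + z) ` Y = vadd (quotient_nspace sc Y) ((\<lambda>y. x + y) ` Y) ((\<lambda>z. y + z) ` Y)"
    proof -
      have "\<exists>u v. x + y + z = u + v \<and> u \<in> (+) x ` Y \<and> v \<in> (+) y ` Y" if "z \<in> Y" for z
        using that Y0 by (intro exI[of _ "x + z"] exI[of _ "y + 0"]) (auto simp: algebra_simps)
      moreover have "(x + u) + (y + v) \<in> (\<lambda>z. x + y + z) ` Y" if "u \<in> Y" "v \<in> Y" for u v
        using Yadd[OF that] by (intro image_eqI[of _ _ "u + v"]) (auto simp: algebra_simps)
      ultimately show ?thesis by (fastforce simp: quotient_nspace_def)
    qed
    show "(\<lambda>y. sc c x + y) ` Y = vscale (quotient_nspace sc Y) c ((\<lambda>y. x + y) ` Y)"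
    proof -
      have "\<exists>a z'. sc c x + z = sc c a + z' \<and> a \<in> (+) x ` Y \<and> z' \<in> Y" if "z \<in> Y" for z
        using that Y0 by (intro exI[of _ "x + 0"] exI[of _ z]) auto
      moreover have "sc c (x + u) + v \<in> (\<lambda>y. sc c x + y) ` Y" if "u \<in> Y" "v \<in> Y" for u v
        using Yadd[OF Yscale[OF that(1)] that(2)]
        by (intro image_eqI[of _ _ "sc c u + v"]) (auto simp: scale_right_distrib algebra_simps)
      ultimately show ?thesis by (fastforce simp: quotient_nspace_def)
    qed
    have bdd: "bdd_below (norm ` A)" for A :: "'a set" by (rule bdd_belowI[of _ 0]) auto
    show "vnorm (quotient_nspace sc Y) ((\<lambda>y. x + y) ` Y) \<le> norm x"
    proof -
      have "norm x \<in> norm ` (\<lambda>y. x + y) ` Y"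
        using Y0 by (intro image_eqI[of _ norm x] image_eqI[of x _ 0]) auto
      then show ?thesis unfolding quotient_nspace_def by (simp add: cInf_lower[OF _ bdd])
    qed
  next
    fix v and e :: real assume "v \<in> vecs (quotient_nspace sc Y)" "0 < e"
    then obtain x where v: "v = (\<lambda>y. x + y) ` Y" by (auto simp: quotient_nspace_def)
    \<comment> \<open>An element of the coset with nearly minimal norm represents the same coset, so
      it is the required lift.\<close>
    obtain a where a: "a \<in> v" "norm a < Inf (norm ` v) + e"
      using cInf_lessD[of "norm ` v" "Inf (norm ` v) + e"] \<open>0 < e\<close> Y0 by (auto simp: v)
    then obtain y where y: "y \<in> Y" "a = x + y" using v by blast
    have "(\<lambda>y. a + y) ` Y = v"
    proof -
      have "a + z \<in> v" if "z \<in> Y" for z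
        unfolding v y(2) using Yadd[OF y(1) that] by (intro image_eqI[of _ _ "y + z"]) (auto simp: algebra_simps)
      moreover have "x + z \<in> (\<lambda>y. a + y) ` Y" if "z \<in> Y" for z
        unfolding y(2) using Yadd[OF that Yscale[OF y(1), of "- 1"]]
        by (intro image_eqI[of _ _ "z + sc (- 1) y"]) (auto simp: algebra_simps)
      ultimately show ?thesis unfolding v by blast
    qed
    then show "\<exists>x. (\<lambda>y. x + y) ` Y = v \<and> norm x < vnorm (quotient_nspace sc Y) v + e"
      using a(2) by (auto simp: quotient_nspace_def)
  qed
qed

text \<open>Functionals in the annihilator are constant on cosets, so reflexivity of the quotient
  yields the assumption \<open>refl\<close> of the real analysis.\<close>

lemma reflexive_quotient_real:
  fixes \<Phi> :: "('a \<Rightarrow>\<^sub>L real) \<Rightarrow>\<^sub>L real"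
  assumes Y: "module.subspace sc Y" and "reflexive_nspace (quotient_nspace sc Y)"
  shows "\<exists>x. \<forall>F\<in>annihilator Y. blinfun_apply \<Phi> F = blinfun_apply F x"
proof -
  interpret quotient_map sc re j "quotient_nspace sc Y" "\<lambda>x. (\<lambda>y. x + y) ` Y"
    by (rule quotient_map_quotient[OF Y])
  have "blinfun_apply F x = blinfun_apply F y"
    if "F \<in> annihilator Y" "(\<lambda>z. x + z) ` Y = (\<lambda>z. y + z) ` Y" for F x y
  proof -
    have "x + 0 \<in> (\<lambda>z. y + z) ` Y" using that(2) Y unfolding subspace_def by blast
    then show ?thesis using that(1) by (auto simp: annihilator_def blinfun.add_right)
  qed
  note factors = this
  from reflexive_nspace_real[OF assms(2), of \<Phi>] show ?thesis
    by (elim ex_forward, intro ballI) (erule allE, erule mp, intro allI impI, rule factors)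
qed

lemma grothendieck_whole_real:
  fixes F :: "nat \<Rightarrow> 'a \<Rightarrow>\<^sub>L real" and \<Phi> :: "('a \<Rightarrow>\<^sub>L real) \<Rightarrow>\<^sub>L real"
  assumes "grothendieck (whole_nspace sc)"
    and lim: "\<And>x. (\<lambda>n. blinfun_apply (F n) x) \<longlonglongrightarrow> blinfun_apply G x"
  shows "(\<lambda>n. blinfun_apply \<Phi> (F n)) \<longlonglongrightarrow> blinfun_apply \<Phi> G"
proof -
  interpret quotient_map sc re j "whole_nspace sc" id by (rule quotient_map_whole)
  have "\<exists>h\<in>vecs (dual (whole_nspace sc)). (\<forall>x. h x = scalar_functional F x) \<and> real_functional h = F" for F
    by (rule ex_dual_of_real[of F]) auto
  then obtain h where h: "\<And>F. h F \<in> vecs (dual (whole_nspace sc))"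
    "\<And>F x. h F x = scalar_functional F x" "\<And>F. real_functional (h F) = F"
    by metis
  have "weak_star_converges_to (whole_nspace sc) (\<lambda>n. h (F n)) (h G)"
    unfolding weak_star_converges_to_def h(2) scalar_functional_def
    by (intro ballI tendsto_intros lim)
  then obtain k where k: "k \<in> vecs (dual (whole_nspace sc))"
    "weakly_converges_to (dual (whole_nspace sc)) (\<lambda>n. h (F n)) k"
    using assms(1) h(1) unfolding grothendieck_def by meson
  have weak: "(\<lambda>n. blinfun_apply \<Phi> (F n)) \<longlonglongrightarrow> blinfun_apply \<Phi> (real_functional k)"
    for \<Phi> :: "('a \<Rightarrow>\<^sub>L real) \<Rightarrow>\<^sub>L real"
  proof -
    obtain \<Psi> where \<Psi>: "\<Psi> \<in> vecs (dual (dual (whole_nspace sc)))"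
      "\<And>h. h \<in> vecs (dual (whole_nspace sc)) \<Longrightarrow> re (\<Psi> h) = blinfun_apply \<Phi> (real_functional h)"
      using ex_bidual_of_real by blast
    have "(\<lambda>n. re (\<Psi> (h (F n)))) \<longlonglongrightarrow> re (\<Psi> k)"
      using bounded_linear.tendsto[OF bounded_linear_re] k(2) \<Psi>(1) unfolding weakly_converges_to_def by blast
    then show ?thesis by (simp add: \<Psi>(2) h k(1))
  qed
  \<comment> \<open>The definition provides only some weak limit \<open>k\<close>; testing with
    evaluations at vectors identifies it with the pointwise limit.\<close>
  have "real_functional k = G"
  proof (rule blinfun_eqI)
    fix x
    have ev: "blinfun_apply (Blinfun (\<lambda>F :: 'a \<Rightarrow>\<^sub>L real. blinfun_apply F x)) = (\<lambda>F. blinfun_apply F x)"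
      by (rule bounded_linear_Blinfun_apply) (rule blinfun.bounded_linear_left)
    show "blinfun_apply (real_functional k) x = blinfun_apply G x"
      using LIMSEQ_unique[OF _ lim] weak[of "Blinfun (\<lambda>F. blinfun_apply F x)"] unfolding ev by blast
  qed
  then show ?thesis using weak by blast
qed

section \<open>The Grothendieck property of the subspace\<close>

lemma grothendieck_subspace:
  assumes Y: "module.subspace sc Y" and "closed Y"
    and "grothendieck (whole_nspace sc)" and "reflexive_nspace (quotient_nspace sc Y)"
  shows "grothendieck (subspace_nspace sc Y)"
  unfolding grothendieck_def
proof (intro allI impI, elim conjE bexE)
  let ?Z = "subspace_nspace sc Y"
  fix f g
  assume f: "\<forall>n. f n \<in> vecs (dual ?Z)" and g: "g \<in> vecs (dual ?Z)"
    and "weak_star_converges_to ?Z f g"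
  then have lim: "(\<lambda>n. f n y) \<longlonglongrightarrow> g y" if "y \<in> Y" for y
    using that unfolding weak_star_converges_to_def by (simp add: subspace_nspace_simps)
  have Y0: "0 \<in> Y" and Yadd: "\<And>x y. x \<in> Y \<Longrightarrow> y \<in> Y \<Longrightarrow> x + y \<in> Y"
    and Yscale: "\<And>c x. x \<in> Y \<Longrightarrow> sc c x \<in> Y"
    using Y unfolding subspace_def by auto
  have YR: "real_vector.subspace Y"
    unfolding real_vector.subspace_def using Y0 Yadd Yscale scale_of_real by metis
  have dual_Y: "f (x + y) = f x + f y" "f (sc c x) = c * f x" "f (t *\<^sub>R x) = t *\<^sub>R f x"
    if "f \<in> vecs (dual ?Z)" "x \<in> Y" "y \<in> Y" for f x y c t
    using that scale_of_real[of t x, symmetric]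
    by (simp_all add: mem_dual_iff subspace_nspace_simps scaleR_conv_of_real)
  have extend: "\<exists>F :: 'a \<Rightarrow>\<^sub>L real. (\<forall>y\<in>Y. blinfun_apply F y = re (f y)) \<and> norm F \<le> M"
    if f: "f \<in> vecs (dual ?Z)" and M: "0 \<le> M" "\<And>y. y \<in> Y \<Longrightarrow> \<bar>re (f y)\<bar> \<le> M * norm y" for f M
  proof (rule hahn_banach_extension[OF YR, of "\<lambda>y. re (f y)" M])
    show "re (f (x + y)) = re (f x) + re (f y)" if "x \<in> Y" "y \<in> Y" for x y
      using dual_Y[OF f] that by (simp add: re_add)
    show "re (f (t *\<^sub>R x)) = t * re (f x)" if "x \<in> Y" for t x
      using dual_Y(3)[OF f that that] by (simp add: re_scaleR)
  qed (use M in auto)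
  have ex: "\<exists>F :: 'a \<Rightarrow>\<^sub>L real. \<forall>y\<in>Y. blinfun_apply F y = re (f y)" if f: "f \<in> vecs (dual ?Z)" for f
  proof -
    obtain B where B: "\<And>y. y \<in> Y \<Longrightarrow> norm (f y) \<le> B * norm y"
      using f unfolding mem_dual_iff subspace_nspace_simps by blast
    have "\<bar>re (f y)\<bar> \<le> \<bar>B\<bar> * norm y" if "y \<in> Y" for y
      using abs_re_le[of "f y"] B[OF that] mult_right_mono[OF abs_ge_self[of B] norm_ge_zero[of y]] by linarith
    then show ?thesis using extend[OF f, of "\<bar>B\<bar>"] by auto
  qed
  obtain G :: "'a \<Rightarrow>\<^sub>L real" where G: "\<And>y. y \<in> Y \<Longrightarrow> blinfun_apply G y = re (g y)"
    using ex[OF g] by blast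
  have re_lim: "(\<lambda>n. re (f n y)) \<longlonglongrightarrow> re (g y)" if "y \<in> Y" for y
    by (rule bounded_linear.tendsto[OF bounded_linear_re lim[OF that]])
  \<comment> \<open>The functionals are extended twice: first with no common bound, merely to apply
    uniform boundedness on \<open>Y\<close>, and then again with norm at most the resulting
    \<open>M\<close>.\<close>
  obtain M where M: "0 \<le> M" "\<And>n y. y \<in> Y \<Longrightarrow> \<bar>re (f n y)\<bar> \<le> M * norm y"
  proof -
    have "\<forall>n. \<exists>F :: 'a \<Rightarrow>\<^sub>L real. \<forall>y\<in>Y. blinfun_apply F y = re (f n y)" using ex f by blast
    then obtain F0 :: "nat \<Rightarrow> 'a \<Rightarrow>\<^sub>L real" where F0: "\<forall>n. \<forall>y\<in>Y. blinfun_apply (F0 n) y = re (f n y)"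
      unfolding choice_iff by blast
    have "bounded (range (\<lambda>n. blinfun_apply (F0 n) y))" if "y \<in> Y" for y
      using convergent_imp_bounded[OF re_lim[OF that]] F0 that by simp
    from uniform_boundedness_on[OF YR \<open>closed Y\<close> this] show ?thesis
      using F0 that by (metis (no_types, lifting))
  qed
  have "\<forall>n. \<exists>F :: 'a \<Rightarrow>\<^sub>L real. (\<forall>y\<in>Y. blinfun_apply F y = re (f n y)) \<and> norm F \<le> M"
    using extend[OF _ M(1)] M(2) f by blast
  then obtain F :: "nat \<Rightarrow> 'a \<Rightarrow>\<^sub>L real" where "\<forall>n. (\<forall>y\<in>Y. blinfun_apply (F n) y = re (f n y)) \<and> norm (F n) \<le> M"
    unfolding choice_iff by blast
  then have F: "\<And>n y. y \<in> Y \<Longrightarrow> blinfun_apply (F n) y = re (f n y)" "\<And>n. norm (F n) \<le> M" by auto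
  \<comment> \<open>Restriction to \<open>Y\<close>, made scalar-valued and set to 0 off
    \<open>Y\<close> as membership in \<open>dual\<close> demands. Composing with it turns an
    element of the bidual of \<open>Y\<close> into a functional on the dual of the whole
    space.\<close>
  define \<rho> where "\<rho> F x = (if x \<in> Y then scalar_functional F x else 0)" for F x
  have \<rho>_eq: "\<rho> F = f" if f: "f \<in> vecs (dual ?Z)" and F: "\<And>y. y \<in> Y \<Longrightarrow> blinfun_apply F y = re (f y)" for F f
  proof
    show "\<rho> F x = f x" for x
      using scalar_functional_eqI[of f x F] dual_Y(2)[OF f] F Yscale f
      by (auto simp: \<rho>_def mem_dual_iff subspace_nspace_simps)
  qed
  define C where "C = 1 + norm j * norm j"
  have \<rho>_le: "norm (\<rho> F y) \<le> norm F * C * norm y" for F y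
    using norm_scalar_functional_le[of F y] by (simp add: \<rho>_def C_def)
  have \<rho>_mem: "\<rho> F \<in> vecs (dual ?Z)" for F
    unfolding mem_dual_iff subspace_nspace_simps
  proof (intro conjI)
    show "\<exists>B. \<forall>x\<in>Y. norm (\<rho> F x) \<le> B * norm x" using \<rho>_le by blast
  qed (use Yadd Yscale in \<open>auto simp: \<rho>_def scalar_functional_add scalar_functional_scale\<close>)
  have \<rho>_norm: "0 \<le> vnorm (dual ?Z) (\<rho> F)" "vnorm (dual ?Z) (\<rho> F) \<le> norm F * C" for F
  proof -
    let ?S = "{norm (\<rho> F x) | x. x \<in> Y \<and> norm x \<le> 1}"
    have zero: "norm (\<rho> F 0) \<in> ?S" using Y0 by (intro CollectI exI[of _ 0]) simp
    have le: "s \<le> norm F * C" if "s \<in> ?S" for s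
    proof -
      obtain x where x: "s = norm (\<rho> F x)" "norm x \<le> 1" using \<open>s \<in> ?S\<close> by blast
      have "norm F * C * norm x \<le> norm F * C * 1"
        using x(2) by (intro mult_left_mono) (auto simp: C_def)
      then show ?thesis using \<rho>_le[of F x] x(1) by simp
    qed
    have "norm (\<rho> F 0) \<le> Sup ?S" by (rule cSup_upper[OF zero]) (use le in \<open>rule bdd_aboveI\<close>)
    then show "0 \<le> vnorm (dual ?Z) (\<rho> F)"
      unfolding dual_simps subspace_nspace_simps using norm_ge_zero order_trans by blast
    show "vnorm (dual ?Z) (\<rho> F) \<le> norm F * C"
      unfolding dual_simps subspace_nspace_simps using zero le by (intro cSup_least) blast+
  qed
  have "weakly_converges_to (dual ?Z) f g"
    unfolding weakly_converges_to_def
  proof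
    fix \<phi> assume \<phi>: "\<phi> \<in> vecs (dual (dual ?Z))"
    then have \<phi>_add: "\<phi> (\<lambda>x. h x + k x) = \<phi> h + \<phi> k" and \<phi>_scale: "\<phi> (\<lambda>x. c * h x) = c * \<phi> h"
      if "h \<in> vecs (dual ?Z)" "k \<in> vecs (dual ?Z)" for h k c
      using that unfolding mem_dual_iff[of \<phi>] dual_simps(1,2) by blast+
    obtain B where B: "\<And>h. h \<in> vecs (dual ?Z) \<Longrightarrow> norm (\<phi> h) \<le> B * vnorm (dual ?Z) h"
      using \<phi> unfolding mem_dual_iff[of \<phi>] by blast
    \<comment> \<open>The factor \<open>c\<close> is used below with the values 1 and
      \<open>j\<close>, whose real parts together recover the scalar limit.\<close>
    have re_lim: "(\<lambda>n. re (c * \<phi> (f n))) \<longlonglongrightarrow> re (c * \<phi> g)" for c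
    proof -
      have "bounded_linear (\<lambda>F. re (c * \<phi> (\<rho> F)))"
      proof (rule bounded_linear_intro[of _ "norm c * (\<bar>B\<bar> * C)"])
        fix F H :: "'a \<Rightarrow>\<^sub>L real" and t :: real
        have "\<rho> (F + H) = (\<lambda>x. \<rho> F x + \<rho> H x)"
          by (auto simp: \<rho>_def scalar_functional_def blinfun.add_left algebra_simps)
        then show "re (c * \<phi> (\<rho> (F + H))) = re (c * \<phi> (\<rho> F)) + re (c * \<phi> (\<rho> H))"
          using \<phi>_add[OF \<rho>_mem \<rho>_mem] by (simp add: distrib_left re_add)
        have "\<rho> (t *\<^sub>R F) = (\<lambda>x. of_real t * \<rho> F x)"
          by (auto simp: \<rho>_def scalar_functional_def blinfun.scaleR_left algebra_simps)
        then have "c * \<phi> (\<rho> (t *\<^sub>R F)) = t *\<^sub>R (c * \<phi> (\<rho> F))"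
          using \<phi>_scale[OF \<rho>_mem \<rho>_mem] by (simp add: scaleR_conv_of_real)
        then show "re (c * \<phi> (\<rho> (t *\<^sub>R F))) = t *\<^sub>R re (c * \<phi> (\<rho> F))"
          by (simp add: re_scaleR)
        have "norm (\<phi> (\<rho> F)) \<le> \<bar>B\<bar> * vnorm (dual ?Z) (\<rho> F)"
          using B[OF \<rho>_mem] mult_right_mono[OF abs_ge_self \<rho>_norm(1)] by (rule order_trans)
        also have "\<dots> \<le> \<bar>B\<bar> * (norm F * C)" using \<rho>_norm(2) by (rule mult_left_mono) simp
        finally have "norm (c * \<phi> (\<rho> F)) \<le> norm c * (\<bar>B\<bar> * (norm F * C))"
          unfolding norm_mult by (rule mult_left_mono) simp
        then show "norm (re (c * \<phi> (\<rho> F))) \<le> norm F * (norm c * (\<bar>B\<bar> * C))"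
          using abs_re_le[of "c * \<phi> (\<rho> F)"] by (simp add: algebra_simps)
      qed
      then have ap: "blinfun_apply (Blinfun (\<lambda>F. re (c * \<phi> (\<rho> F)))) = (\<lambda>F. re (c * \<phi> (\<rho> F)))"
        by (rule bounded_linear_Blinfun_apply)
      have "(\<lambda>n. blinfun_apply (Blinfun (\<lambda>F. re (c * \<phi> (\<rho> F)))) (F n))
        \<longlonglongrightarrow> blinfun_apply (Blinfun (\<lambda>F. re (c * \<phi> (\<rho> F)))) G"
      proof (rule tendsto_of_annihilating_functional[OF YR \<open>closed Y\<close>])
        show "\<exists>x. \<forall>F\<in>annihilator Y. blinfun_apply \<Phi> F = blinfun_apply F x"
          for \<Phi> :: "('a \<Rightarrow>\<^sub>L real) \<Rightarrow>\<^sub>L real"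
          by (rule reflexive_quotient_real[OF Y assms(4)])
        show "(\<lambda>n. blinfun_apply \<Phi> (F n)) \<longlonglongrightarrow> blinfun_apply \<Phi> G"
          if "\<And>x. (\<lambda>n. blinfun_apply (F n) x) \<longlonglongrightarrow> blinfun_apply G x"
          for F :: "nat \<Rightarrow> 'a \<Rightarrow>\<^sub>L real" and G and \<Phi> :: "('a \<Rightarrow>\<^sub>L real) \<Rightarrow>\<^sub>L real"
          by (rule grothendieck_whole_real[OF assms(3) that])
        show "norm (F n) \<le> M" for n by (rule F(2))
        show "(\<lambda>n. blinfun_apply (F n) y) \<longlonglongrightarrow> blinfun_apply G y" if "y \<in> Y" for y
          using re_lim[OF that] by (simp add: F(1) G that)
        show "blinfun_apply (Blinfun (\<lambda>F. re (c * \<phi> (\<rho> F)))) H = 0" if "H \<in> annihilator Y" for H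
        proof -
          \<comment> \<open>\<open>Y\<close> is closed under multiplication by \<open>j\<close>, so
            \<open>H\<close> vanishes at both arguments in \<open>scalar_functional\<close>. Writing
            the zero functional as a multiple by 0 lets homogeneity of \<open>\<phi>\<close>
            apply.\<close>
          have "\<rho> H = (\<lambda>x. 0 * \<rho> H x)"
            using that Yscale by (auto simp: \<rho>_def scalar_functional_def annihilator_def)
          then have "\<phi> (\<rho> H) = 0" using \<phi>_scale[OF \<rho>_mem \<rho>_mem, of 0 H] by simp
          then show ?thesis unfolding ap using re_of_real[of 0] by simp
        qed
      qed
      then show ?thesis using \<rho>_eq[OF f[rule_format] F(1)] \<rho>_eq[OF g G] by (simp add: ap)
    qed
    have "(\<lambda>n. of_real (re (1 * \<phi> (f n))) - j * of_real (re (j * \<phi> (f n))))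
      \<longlonglongrightarrow> of_real (re (1 * \<phi> g)) - j * of_real (re (j * \<phi> g))"
      by (intro tendsto_intros re_lim)
    then show "(\<lambda>n. \<phi> (f n)) \<longlonglongrightarrow> \<phi> g"
      by (simp flip: decomposition)
  qed
  then show "\<exists>h\<in>vecs (dual ?Z). weakly_converges_to (dual ?Z) f h" using g by blast
qed

end

theorem corollary1p4:
  fixes sc :: "'k::real_or_complex_field \<Rightarrow> 'a::banach \<Rightarrow> 'a"
    and Y :: "'a set"
  assumes "banach_space_over sc"
    and "module.subspace sc Y" and "closed Y"
    and "grothendieck (whole_nspace sc)"
    and "reflexive_nspace (quotient_nspace sc Y)"
  shows "grothendieck (subspace_nspace sc Y)"
proof -
  obtain re :: "'k \<Rightarrow> real" and j where "real_part re j" by (rule ex_real_part)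
  then interpret scalar_banach_space sc re j
    using assms(1) by (intro scalar_banach_space.intro)
  show ?thesis by (rule grothendieck_subspace) (rule assms)+
qed

end
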